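(* Let $(X,\mu)$ be a uniform space satisfying that the realcompactifications $\upsilon X$ and $H(U_\mu(X))$ are equivalent. Then $C(X)=CC_{wU_\mu(X)}(X)$. In particular, if $(X,d)$ is a metric space such that $\upsilon X$ and $H(U_{\mu_d}(X))$ are equivalent realcompactifications, then $(X,d)$ is Bourbaki-complete.
   Context: Uniform spaces are Hausdorff and given by covers. $C(X)$ is the set of real-valued continuous functions on $X$; $U_\mu(X)$ is the set of real-valued uniformly continuous functions on $(X,\mu)$; $wU_\mu(X)$ is the weakest uniformity on $X$ making all $f\in U_\mu(X)$ uniformly continuous. For a uniformity $\nu$ on $X$, $CC_\nu(X)$ is the set of real-valued Cauchy-continuous functions on $(X,\nu)$, i.e. functions $f:X\to\mathbb R$ mapping Cauchy filters of $(X,\nu)$ to (bases of) Cauchy filters of $\mathbb R$. A space is realcompact if it is homeomorphic to a closed subspace of a product of real lines; a realcompactification of $X$ is a realcompact space in which $X$ is densely embedded. Two realcompactifications of $X$ are equivalent if there is a homeomorphism between them leaving $X$ pointwise fixed. $\upsilon X$ is the Hewitt realcompactification of $X$ (the smallest realcompactification to which every $f\in C(X)$ extends continuously). $H(U_\mu(X))$ is the Samuel realcompactification of $(X,\mu)$: the smallest realcompactification to which every $f\in U_\mu(X)$ extends continuously; topologically it is the completion of $(X,wU_\mu(X))$. For a metric space $(X,d)$, $\mu_d$ is the metric uniformity (covers refined by $\{B_d(x,\varepsilon):x\in X\}$ for some $\varepsilon>0$). For a cover $\mathcal U$ and $A\subset X$: $St(A,\mathcal U)=\bigcup\{U\in\mathcal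 U: U\cap A\neq\emptyset\}$, $St^0(A,\mathcal U)=A$, $St^m(A,\mathcal U)=St(St^{m-1}(A,\mathcal U),\mathcal U)$ for $m\ge1$. A filter $\mathcal F$ is Bourbaki-Cauchy if for every $\mathcal U\in\mu_d$ there are $m\in\mathbb N$, $U\in\mathcal U$ and $F\in\mathcal F$ with $F\subset St^m(U,\mathcal U)$. $(X,d)$ is Bourbaki-complete if every Bourbaki-Cauchy filter has a cluster point. *)

theory Defs
  imports "HOL-Analysis.Analysis"
begin

definition cover_of :: "'a set \<Rightarrow> 'a set set \<Rightarrow> bool"
  where "cover_of X \<U> \<longleftrightarrow> \<U> \<subseteq> Pow X \<and> \<Union>\<U> = X"

definition refines :: "'a set set \<Rightarrow> 'a set set \<Rightarrow> bool"
  where "refines \<V> \<U> \<longleftrightarrow> (\<forall>V\<in>\<V>. \<exists>U\<in>\<U>. V \<subseteq> U)"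

definition St :: "'a set \<Rightarrow> 'a set set \<Rightarrow> 'a set"
  where "St A \<U> = \<Union>{U \<in> \<U>. U \<inter> A \<noteq> {}}"

primrec St_iter :: "nat \<Rightarrow> 'a set \<Rightarrow> 'a set set \<Rightarrow> 'a set" where
  "St_iter 0 A \<U> = A"
| "St_iter (Suc m) A \<U> = St (St_iter m A \<U>) \<U>"

definition star_refines :: "'a set set \<Rightarrow> 'a set set \<Rightarrow> bool"
  where "star_refines \<V> \<U> \<longleftrightarrow> refines ((\<lambda>V. St V \<V>) ` \<V>) \<U>"

text \<open>The last condition says that the uniformity is Hausdorff.\<close>

definition covering_uniformity :: "'a set \<Rightarrow> 'a set set set \<Rightarrow> bool"
  where "covering_uniformity X \<mu> \<longleftrightarrow>
    \<mu> \<noteq> {} \<and>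
    (\<forall>\<U>\<in>\<mu>. cover_of X \<U>) \<and>
    (\<forall>\<U>\<in>\<mu>. \<forall>\<V>. cover_of X \<V> \<and> refines \<U> \<V> \<longrightarrow> \<V> \<in> \<mu>) \<and>
    (\<forall>\<U>\<in>\<mu>. \<forall>\<V>\<in>\<mu>. \<exists>\<W>\<in>\<mu>. refines \<W> \<U> \<and> refines \<W> \<V>) \<and>
    (\<forall>\<U>\<in>\<mu>. \<exists>\<V>\<in>\<mu>. star_refines \<V> \<U>) \<and>
    (\<forall>x\<in>X. \<forall>y\<in>X. x \<noteq> y \<longrightarrow> (\<exists>\<U>\<in>\<mu>. y \<notin> St {x} \<U>))"

definition uniform_topology :: "'a set \<Rightarrow> 'a set set set \<Rightarrow> 'a topology"
  where "uniform_topology X \<mu> =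
    topology (\<lambda>S. S \<subseteq> X \<and> (\<forall>x\<in>S. \<exists>\<U>\<in>\<mu>. St {x} \<U> \<subseteq> S))"

definition metric_uniformity :: "'a set \<Rightarrow> ('a \<Rightarrow> 'a \<Rightarrow> real) \<Rightarrow> 'a set set set"
  where "metric_uniformity X d =
    {\<U>. cover_of X \<U> \<and> (\<exists>\<epsilon>>0. refines ((\<lambda>x. Metric_space.mball X d x \<epsilon>) ` X) \<U>)}"

abbreviation real_uniformity :: "real set set set"
  where "real_uniformity \<equiv> metric_uniformity UNIV dist"

text \<open>
  Real-valued functions on a carrier \<open>X\<close> are represented by total functions on the ambient type;
  membership in each of the classes below depends only on the values on \<open>X\<close>.
\<close>

definition unif_continuous ::
    "'a set \<Rightarrow> 'a set set set \<Rightarrow> 'b set \<Rightarrow> 'b set set set \<Rightarrow> ('a \<Rightarrow> 'b) \<Rightarrow> bool"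
  where "unif_continuous X \<mu> Y \<nu> f \<longleftrightarrow>
    f ` X \<subseteq> Y \<and> (\<forall>\<V>\<in>\<nu>. (\<lambda>V. f -` V \<inter> X) ` \<V> \<in> \<mu>)"

definition C_fun :: "'a topology \<Rightarrow> ('a \<Rightarrow> real) set"
  where "C_fun T = {f. continuous_map T euclideanreal f}"

definition U_fun :: "'a set \<Rightarrow> 'a set set set \<Rightarrow> ('a \<Rightarrow> real) set"
  where "U_fun X \<mu> = {f. unif_continuous X \<mu> UNIV real_uniformity f}"

text \<open>Fewer uniform covers means a weaker uniformity, so the weakest uniformity is the
  least one with respect to inclusion. It exists because \<open>U_fun X \<mu>\<close> separates points.\<close>

definition weak_uniformity :: "'a set \<Rightarrow> 'a set set set \<Rightarrow> 'a set set set"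
  where "weak_uniformity X \<mu> =
    (LEAST \<nu>. covering_uniformity X \<nu> \<and>
       (\<forall>f \<in> U_fun X \<mu>. unif_continuous X \<nu> UNIV real_uniformity f))"

text \<open>Filters on the carrier are proper filters on the ambient type that contain the carrier;
  then \<open>filtermap f F\<close> is the filter with base the images of the members of \<open>F\<close>.\<close>

definition filter_on :: "'a set \<Rightarrow> 'a filter \<Rightarrow> bool"
  where "filter_on X F \<longleftrightarrow> F \<noteq> bot \<and> F \<le> principal X"

definition Cauchy_filter_on :: "'a set \<Rightarrow> 'a set set set \<Rightarrow> 'a filter \<Rightarrow> bool"
  where "Cauchy_filter_on X \<mu> F \<longleftrightarrow>
    filter_on X F \<and> (\<forall>\<U>\<in>\<mu>. \<exists>U\<in>\<U>. \<forall>\<^sub>F x in F. x \<in> U)"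

definition CC_fun :: "'a set \<Rightarrow> 'a set set set \<Rightarrow> ('a \<Rightarrow> real) set"
  where "CC_fun X \<nu> =
    {f. \<forall>F. Cauchy_filter_on X \<nu> F \<longrightarrow> Cauchy_filter_on UNIV real_uniformity (filtermap f F)}"

text \<open>A definition cannot quantify over index sets of arbitrary type, but indexing by sets of
  functions on the space itself is no restriction, see \<open>realcompact_spaceI\<close> below.\<close>

definition realcompact_space :: "'a topology \<Rightarrow> bool"
  where "realcompact_space Y \<longleftrightarrow>
    (\<exists>(I :: ('a \<Rightarrow> real) set) C.
       closedin (product_topology (\<lambda>_. euclideanreal) I) C \<and>
       Y homeomorphic_space subtopology (product_topology (\<lambda>_. euclideanreal) I) C)"

definition realcompactification :: "'a topology \<Rightarrow> 'b topology \<Rightarrow> ('a \<Rightarrow> 'b) \<Rightarrow> bool"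
  where "realcompactification T Y e \<longleftrightarrow>
    realcompact_space Y \<and> embedding_map T Y e \<and> Y closure_of (e ` topspace T) = topspace Y"

definition equivalent_realcompactifications ::
    "'a topology \<Rightarrow> 'b topology \<Rightarrow> ('a \<Rightarrow> 'b) \<Rightarrow> 'c topology \<Rightarrow> ('a \<Rightarrow> 'c) \<Rightarrow> bool"
  where "equivalent_realcompactifications T Y e Z k \<longleftrightarrow>
    (\<exists>h. homeomorphic_map Y Z h \<and> (\<forall>x \<in> topspace T. h (e x) = k x))"

definition realcompactification_le ::
    "'a topology \<Rightarrow> 'b topology \<Rightarrow> ('a \<Rightarrow> 'b) \<Rightarrow> 'c topology \<Rightarrow> ('a \<Rightarrow> 'c) \<Rightarrow> bool"
  where "realcompactification_le T Y e Z k \<longleftrightarrow>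
    (\<exists>h. continuous_map Z Y h \<and> (\<forall>x \<in> topspace T. h (k x) = e x))"

definition extends_to :: "'a topology \<Rightarrow> 'b topology \<Rightarrow> ('a \<Rightarrow> 'b) \<Rightarrow> ('a \<Rightarrow> real) \<Rightarrow> bool"
  where "extends_to T Y e f \<longleftrightarrow>
    (\<exists>g. continuous_map Y euclideanreal g \<and> (\<forall>x \<in> topspace T. g (e x) = f x))"

text \<open>The smallest realcompactification to which all functions in \<open>L\<close> extend. The competitors
  \<open>Z\<close> live on the type \<open>('a => real) => real\<close>; as every realcompactification has a copy on that
  type, minimality holds against realcompactifications of any type, see
  \<open>smallest_realcompactification_le\<close> below.\<close>

definition smallest_realcompactification ::
    "'a topology \<Rightarrow> ('a \<Rightarrow> real) set \<Rightarrow> 'b topology \<Rightarrow> ('a \<Rightarrow> 'b) \<Rightarrow> bool"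
  where "smallest_realcompactification T L Y e \<longleftrightarrow>
    realcompactification T Y e \<and> (\<forall>f\<in>L. extends_to T Y e f) \<and>
    (\<forall>(Z :: (('a \<Rightarrow> real) \<Rightarrow> real) topology) k.
       realcompactification T Z k \<and> (\<forall>f\<in>L. extends_to T Z k f)
       \<longrightarrow> realcompactification_le T Y e Z k)"

definition Hewitt_realcompactification :: "'a topology \<Rightarrow> 'b topology \<Rightarrow> ('a \<Rightarrow> 'b) \<Rightarrow> bool"
  where "Hewitt_realcompactification T Y e \<longleftrightarrow>
    smallest_realcompactification T (C_fun T) Y e"

definition Samuel_realcompactification ::
    "'a set \<Rightarrow> 'a set set set \<Rightarrow> 'b topology \<Rightarrow> ('a \<Rightarrow> 'b) \<Rightarrow> bool"
  where "Samuel_realcompactification X \<mu> Y e \<longleftrightarrow>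
    smallest_realcompactification (uniform_topology X \<mu>) (U_fun X \<mu>) Y e"

definition Bourbaki_Cauchy_filter :: "'a set \<Rightarrow> ('a \<Rightarrow> 'a \<Rightarrow> real) \<Rightarrow> 'a filter \<Rightarrow> bool"
  where "Bourbaki_Cauchy_filter X d F \<longleftrightarrow>
    filter_on X F \<and>
    (\<forall>\<U> \<in> metric_uniformity X d. \<exists>m. \<exists>U\<in>\<U>. \<forall>\<^sub>F x in F. x \<in> St_iter m U \<U>)"

definition cluster_point :: "'a topology \<Rightarrow> 'a filter \<Rightarrow> 'a \<Rightarrow> bool"
  where "cluster_point T F x \<longleftrightarrow>
    x \<in> topspace T \<and> (\<forall>W. openin T W \<and> x \<in> W \<longrightarrow> (\<exists>\<^sub>F y in F. y \<in> W))"

definition Bourbaki_complete :: "'a set \<Rightarrow> ('a \<Rightarrow> 'a \<Rightarrow> real) \<Rightarrow> bool"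
  where "Bourbaki_complete X d \<longleftrightarrow>
    (\<forall>F. Bourbaki_Cauchy_filter X d F \<longrightarrow> (\<exists>x. cluster_point (Metric_space.mtopology X d) F x))"

lemma St_mono_refines:
  assumes "refines \<W> \<U>" shows "St {x} \<W> \<subseteq> St {x} \<U>"
proof
  fix y assume "y \<in> St {x} \<W>"
  then obtain W where "W \<in> \<W>" "x \<in> W" "y \<in> W" unfolding St_def by blast
  moreover then obtain U where "U \<in> \<U>" "W \<subseteq> U" using assms unfolding refines_def by blast
  ultimately show "y \<in> St {x} \<U>" unfolding St_def by blast
qed

lemma openin_uniform_topology:
  assumes "covering_uniformity X \<mu>"
  shows "openin (uniform_topology X \<mu>) S \<longleftrightarrow> S \<subseteq> X \<and> (\<forall>x\<in>S. \<exists>\<U>\<in>\<mu>. St {x} \<U> \<subseteq> S)"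
proof -
  have dir: "\<exists>\<W>\<in>\<mu>. refines \<W> \<U> \<and> refines \<W> \<V>" if "\<U> \<in> \<mu>" "\<V> \<in> \<mu>" for \<U> \<V>
    using assms that unfolding covering_uniformity_def by (elim conjE) blast
  have "istopology (\<lambda>S. S \<subseteq> X \<and> (\<forall>x\<in>S. \<exists>\<U>\<in>\<mu>. St {x} \<U> \<subseteq> S))"
    unfolding istopology_def
  proof (intro conjI allI impI)
    fix S T
    assume S: "S \<subseteq> X \<and> (\<forall>x\<in>S. \<exists>\<U>\<in>\<mu>. St {x} \<U> \<subseteq> S)"
      and T: "T \<subseteq> X \<and> (\<forall>x\<in>T. \<exists>\<U>\<in>\<mu>. St {x} \<U> \<subseteq> T)"
    show "\<forall>x\<in>S \<inter> T. \<exists>\<U>\<in>\<mu>. St {x} \<U> \<subseteq> S \<inter> T"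
    proof
      fix x assume "x \<in> S \<inter> T"
      then obtain \<U> \<V> where "\<U>\<in>\<mu>" "St {x} \<U> \<subseteq> S" "\<V>\<in>\<mu>" "St {x} \<V> \<subseteq> T"
        using S T by blast
      moreover then obtain \<W> where "\<W>\<in>\<mu>" "refines \<W> \<U>" "refines \<W> \<V>"
        using dir by blast
      ultimately show "\<exists>\<U>\<in>\<mu>. St {x} \<U> \<subseteq> S \<inter> T"
        using St_mono_refines by (metis Int_greatest order_trans)
    qed
  next
    fix \<K> assume K: "\<forall>K\<in>\<K>. K \<subseteq> X \<and> (\<forall>x\<in>K. \<exists>\<U>\<in>\<mu>. St {x} \<U> \<subseteq> K)"
    show "\<forall>x\<in>\<Union>\<K>. \<exists>\<U>\<in>\<mu>. St {x} \<U> \<subseteq> \<Union>\<K>"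
    proof
      fix x assume "x \<in> \<Union>\<K>"
      then obtain K where "K \<in> \<K>" "x \<in> K" by blast
      then obtain \<U> where "\<U> \<in> \<mu>" "St {x} \<U> \<subseteq> K" using K by blast
      then show "\<exists>\<U>\<in>\<mu>. St {x} \<U> \<subseteq> \<Union>\<K>" using \<open>K \<in> \<K>\<close> by blast
    qed
  qed blast+
  then show ?thesis
    unfolding uniform_topology_def by (rule topology_inverse'[THEN fun_cong])
qed

lemma topspace_uniform_topology:
  assumes "covering_uniformity X \<mu>"
  shows "topspace (uniform_topology X \<mu>) = X"
proof -
  have "St {x} \<U> \<subseteq> X" if "\<U> \<in> \<mu>" for x \<U>
    using assms that unfolding covering_uniformity_def cover_of_def St_def by fastforce
  moreover have "\<mu> \<noteq> {}" using assms unfolding covering_uniformity_def by blast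
  ultimately have "openin (uniform_topology X \<mu>) X"
    using openin_uniform_topology[OF assms] by auto
  then show ?thesis
    using openin_uniform_topology[OF assms]
    by (metis openin_subset openin_topspace subset_antisym)
qed

context Metric_space
begin

lemma cover_of_mballs:
  assumes "\<epsilon> > 0" shows "cover_of M ((\<lambda>x. mball x \<epsilon>) ` M)"
  using assms unfolding cover_of_def by (auto simp: in_mball)

lemma mballs_in_metric_uniformity:
  assumes "\<epsilon> > 0" shows "(\<lambda>x. mball x \<epsilon>) ` M \<in> metric_uniformity M d"
proof -
  let ?B = "(\<lambda>x. mball x \<epsilon>) ` M"
  have "refines ?B ?B" unfolding refines_def by blast
  then show ?thesis
    using assms cover_of_mballs[OF assms] unfolding metric_uniformity_def mem_Collect_eq by metis
qed

lemma St_mballs_subset: "St {x} ((\<lambda>x. mball x (\<epsilon>/2)) ` M) \<subseteq> mball x \<epsilon>"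
proof
  fix y assume "y \<in> St {x} ((\<lambda>x. mball x (\<epsilon>/2)) ` M)"
  then obtain z where z: "z \<in> M" "x \<in> M" "y \<in> M" "d z x < \<epsilon>/2" "d z y < \<epsilon>/2"
    unfolding St_def by auto
  then have "d x y < \<epsilon>"
    using triangle[of x z y] commute by force
  then show "y \<in> mball x \<epsilon>" using z by (simp add: in_mball)
qed

lemma covering_uniformity_metric: "covering_uniformity M (metric_uniformity M d)"
  unfolding covering_uniformity_def
proof (intro conjI ballI allI impI)
  show "metric_uniformity M d \<noteq> {}"
    using mballs_in_metric_uniformity[of 1] by auto
next
  fix \<U> assume "\<U> \<in> metric_uniformity M d"
  then show "cover_of M \<U>" unfolding metric_uniformity_def by blast
next
  fix \<U> \<V> assume U: "\<U> \<in> metric_uniformity M d" and V: "cover_of M \<V> \<and> refines \<U> \<V>"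
  then obtain \<epsilon> where e: "\<epsilon> > 0" "refines ((\<lambda>x. mball x \<epsilon>) ` M) \<U>"
    unfolding metric_uniformity_def by blast
  have "refines ((\<lambda>x. mball x \<epsilon>) ` M) \<V>"
    using e V unfolding refines_def by (meson order_trans)
  then show "\<V> \<in> metric_uniformity M d"
    using e V unfolding metric_uniformity_def by blast
next
  fix \<U> \<V> assume "\<U> \<in> metric_uniformity M d" "\<V> \<in> metric_uniformity M d"
  then obtain \<epsilon> \<delta> where e: "\<epsilon> > 0" "refines ((\<lambda>x. mball x \<epsilon>) ` M) \<U>"
    and d: "\<delta> > 0" "refines ((\<lambda>x. mball x \<delta>) ` M) \<V>"
    unfolding metric_uniformity_def by blast
  let ?W = "(\<lambda>x. mball x (min \<epsilon> \<delta>)) ` M"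
  have sub: "mball x (min \<epsilon> \<delta>) \<subseteq> mball x \<epsilon>" "mball x (min \<epsilon> \<delta>) \<subseteq> mball x \<delta>" for x
    by (auto simp: in_mball)
  have "refines ?W \<U>" "refines ?W \<V>"
    using e d sub unfolding refines_def by (auto, meson order_trans, meson order_trans)
  moreover have "?W \<in> metric_uniformity M d"
    using e d by (intro mballs_in_metric_uniformity) auto
  ultimately show "\<exists>\<W>\<in>metric_uniformity M d. refines \<W> \<U> \<and> refines \<W> \<V>"
    by blast
next
  fix \<U> assume "\<U> \<in> metric_uniformity M d"
  then obtain \<epsilon> where e: "\<epsilon> > 0" "refines ((\<lambda>x. mball x \<epsilon>) ` M) \<U>"
    unfolding metric_uniformity_def by blast
  let ?V = "(\<lambda>x. mball x (\<epsilon>/3)) ` M"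
  have "St (mball x (\<epsilon>/3)) ?V \<subseteq> mball x \<epsilon>" if "x \<in> M" for x
  proof
    fix y assume "y \<in> St (mball x (\<epsilon>/3)) ?V"
    then obtain z w where "z \<in> M" "w \<in> M" "y \<in> M" "d x w < \<epsilon>/3" "d z w < \<epsilon>/3" "d z y < \<epsilon>/3"
      unfolding St_def by auto
    moreover then have "d x y < \<epsilon>"
      using triangle[of x w y] triangle[of w z y] commute[of z w] that by force
    ultimately show "y \<in> mball x \<epsilon>" using that by (simp add: in_mball)
  qed
  then have "star_refines ?V \<U>"
    using e unfolding star_refines_def refines_def by (auto, meson order_trans)
  then show "\<exists>\<V>\<in>metric_uniformity M d. star_refines \<V> \<U>"
    using mballs_in_metric_uniformity[of "\<epsilon>/3"] e by auto
next
  fix x y assume "x \<in> M" "y \<in> M" "x \<noteq> y"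
  then have "d x y > 0" by auto
  moreover have "y \<notin> mball x (d x y)" by (simp add: in_mball)
  ultimately show "\<exists>\<U>\<in>metric_uniformity M d. y \<notin> St {x} \<U>"
    using St_mballs_subset[of x "d x y"] mballs_in_metric_uniformity[of "d x y/2"]
    by (meson half_gt_zero subsetD)
qed

lemma uniform_topology_metric: "uniform_topology M (metric_uniformity M d) = mtopology"
  unfolding topology_eq openin_uniform_topology[OF covering_uniformity_metric] openin_mtopology
proof (intro allI conj_cong refl iffI allI impI ballI)
  fix S x assume "\<forall>x\<in>S. \<exists>\<U>\<in>metric_uniformity M d. St {x} \<U> \<subseteq> S" "x \<in> S" and SM: "S \<subseteq> M"
  then obtain \<U> where U: "\<U> \<in> metric_uniformity M d" "St {x} \<U> \<subseteq> S" by blast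
  then obtain \<epsilon> where e: "\<epsilon> > 0" "refines ((\<lambda>x. mball x \<epsilon>) ` M) \<U>"
    unfolding metric_uniformity_def by blast
  then obtain U where u: "U \<in> \<U>" "mball x \<epsilon> \<subseteq> U"
    using \<open>x \<in> S\<close> SM unfolding refines_def by blast
  then have "x \<in> U" using \<open>x \<in> S\<close> SM e by auto
  then have "U \<subseteq> St {x} \<U>" using u unfolding St_def by auto
  then show "\<exists>r>0. mball x r \<subseteq> S" using u U e by (meson order_trans)
next
  fix S x assume "\<forall>x. x \<in> S \<longrightarrow> (\<exists>r>0. mball x r \<subseteq> S)" "x \<in> S"
  then obtain r where "r > 0" "mball x r \<subseteq> S" by blast
  then show "\<exists>\<U>\<in>metric_uniformity M d. St {x} \<U> \<subseteq> S"
    using St_mballs_subset[of x r] mballs_in_metric_uniformity[of "r/2"]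
    by (meson half_gt_zero order_trans)
qed

end

lemma realcompact_spaceI:
  fixes Y :: "'a topology" and I :: "'i set"
  assumes C: "closedin (product_topology (\<lambda>_. euclideanreal) I) C"
    and Y: "Y homeomorphic_space subtopology (product_topology (\<lambda>_. euclideanreal) I) C"
  shows "realcompact_space Y"
proof -
  let ?P = "product_topology (\<lambda>_. euclideanreal) I"
  obtain \<phi> where \<phi>: "homeomorphic_map Y (subtopology ?P C) \<phi>"
    using Y homeomorphic_space by blast
  have CP: "C \<subseteq> topspace ?P" using C closedin_subset by blast
  then have im: "\<phi> ` topspace Y = C"
    using \<phi> homeomorphic_imp_surjective_map by fastforce
  define g where "g i = restrict (\<lambda>y. \<phi> y i) (topspace Y)" for i
  define J where "J = g ` I"
  let ?Q = "product_topology (\<lambda>_. euclideanreal) J"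
  define s where "s w = restrict (\<lambda>i. w (g i)) I" for w :: "('a \<Rightarrow> real) \<Rightarrow> real"
  define r where "r v = restrict (\<lambda>j. v (inv_into I g j)) J" for v :: "'i \<Rightarrow> real"
  define \<psi> where "\<psi> y = restrict (\<lambda>j. j y) J" for y
  have s: "continuous_map ?Q ?P s"
    unfolding s_def by (intro continuous_map_componentwise[THEN iffD2])
      (auto simp: J_def intro: continuous_map_product_projection)
  have r: "continuous_map ?P ?Q r"
    unfolding r_def by (intro continuous_map_componentwise[THEN iffD2])
      (auto simp: J_def intro!: continuous_map_product_projection inv_into_into)
  have gI: "g (inv_into I g j) = j" "inv_into I g j \<in> I" if "j \<in> J" for j
    using that unfolding J_def by (auto simp: f_inv_into_f inv_into_into)
  have r\<phi>: "r (\<phi> y) = \<psi> y" if "y \<in> topspace Y" for y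
  proof
    fix j show "r (\<phi> y) j = \<psi> y j"
    proof (cases "j \<in> J")
      case True
      have "\<phi> y (inv_into I g j) = g (inv_into I g j) y" using that by (simp add: g_def)
      then show ?thesis using True gI by (simp add: r_def \<psi>_def)
    qed (simp add: r_def \<psi>_def)
  qed
  have s\<psi>: "s (\<psi> y) = \<phi> y" if "y \<in> topspace Y" for y
  proof -
    have "\<phi> y \<in> extensional I" using that im CP by (auto simp: PiE_def)
    then show ?thesis
      using that by (intro extensionalityI[of _ I]) (auto simp: s_def \<psi>_def J_def g_def)
  qed
  define D where "D = {w \<in> topspace ?Q. s w \<in> C}"
  have D: "closedin ?Q D"
    unfolding D_def using closedin_continuous_map_preimage[OF s C] .
  have D\<psi>: "\<exists>y\<in>topspace Y. s w = \<phi> y \<and> w = \<psi> y" if "w \<in> D" for w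
  proof -
    have "s w \<in> \<phi> ` topspace Y" using that im by (simp add: D_def)
    then obtain y where y: "y \<in> topspace Y" "s w = \<phi> y" by blast
    have "w j = \<psi> y j" if "j \<in> J" for j
    proof -
      obtain i where i: "i \<in> I" "j = g i" using \<open>j \<in> J\<close> unfolding J_def by blast
      then have "w j = \<phi> y i" using fun_cong[OF y(2), of i] by (simp add: s_def)
      then show ?thesis using i y \<open>j \<in> J\<close> by (simp add: \<psi>_def g_def)
    qed
    moreover have "w \<in> extensional J" using that unfolding D_def by (auto simp: PiE_def)
    ultimately have "w = \<psi> y" by (intro extensionalityI[of _ J]) (auto simp: \<psi>_def)
    then show ?thesis using y by blast
  qed
  have \<psi>D: "\<psi> y \<in> D" if "y \<in> topspace Y" for y
    using that s\<psi>[OF that] im unfolding D_def by (auto simp: \<psi>_def)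
  have "homeomorphic_maps (subtopology ?P C) (subtopology ?Q D) r s"
    unfolding homeomorphic_maps_def
  proof (intro conjI ballI)
    have rC: "r ` C \<subseteq> D" using im r\<phi> \<psi>D by auto
    show "continuous_map (subtopology ?P C) (subtopology ?Q D) r"
      using r rC by (auto simp: continuous_map_in_subtopology continuous_map_from_subtopology)
    have sD: "s ` D \<subseteq> C" unfolding D_def by auto
    show "continuous_map (subtopology ?Q D) (subtopology ?P C) s"
      using s sD by (auto simp: continuous_map_in_subtopology continuous_map_from_subtopology)
  next
    fix v assume "v \<in> topspace (subtopology ?P C)"
    then obtain y where "y \<in> topspace Y" "v = \<phi> y" using im by auto
    then show "s (r v) = v" by (simp add: r\<phi> s\<psi>)
  next
    fix w assume "w \<in> topspace (subtopology ?Q D)"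
    then obtain y where "y \<in> topspace Y" "s w = \<phi> y" "w = \<psi> y" using D\<psi> by auto
    then show "r (s w) = w" by (simp add: r\<phi>)
  qed
  then have "subtopology ?P C homeomorphic_space subtopology ?Q D"
    unfolding homeomorphic_space_def by blast
  then have "Y homeomorphic_space subtopology ?Q D"
    using Y homeomorphic_space_trans by blast
  then show ?thesis unfolding realcompact_space_def using D by blast
qed

lemma realcompact_space_homeomorphic:
  fixes Z :: "'a topology" and Z' :: "'b topology"
  assumes "realcompact_space Z" "Z' homeomorphic_space Z"
  shows "realcompact_space Z'"
proof -
  obtain I :: "('a \<Rightarrow> real) set" and C where
    "closedin (product_topology (\<lambda>_. euclideanreal) I) C"
    and "Z homeomorphic_space subtopology (product_topology (\<lambda>_. euclideanreal) I) C"
    using assms unfolding realcompact_space_def by blast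
  then show ?thesis
    by (rule realcompact_spaceI[OF _ homeomorphic_space_trans[OF assms(2)]])
qed

lemma realcompact_space_separates:
  fixes Z :: "'a topology"
  assumes "realcompact_space Z" "z \<in> topspace Z" "z' \<in> topspace Z" "z \<noteq> z'"
  shows "\<exists>G. continuous_map Z euclideanreal G \<and> G z \<noteq> G z'"
proof -
  obtain I :: "('a \<Rightarrow> real) set" and C where
    "Z homeomorphic_space subtopology (product_topology (\<lambda>_. euclideanreal) I) C"
    using assms unfolding realcompact_space_def by blast
  then obtain \<phi> where
    \<phi>: "homeomorphic_map Z (subtopology (product_topology (\<lambda>_. euclideanreal) I) C) \<phi>"
    using homeomorphic_space by blast
  then have "\<phi> z \<noteq> \<phi> z'"
    using assms homeomorphic_imp_injective_map inj_onD by metis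
  moreover have c: "continuous_map Z (product_topology (\<lambda>_. euclideanreal) I) \<phi>"
    using \<phi> homeomorphic_imp_continuous_map continuous_map_in_subtopology by blast
  moreover have "\<phi> z \<in> extensional I" "\<phi> z' \<in> extensional I"
    using continuous_map_funspace[OF c] assms by (auto simp: PiE_def)
  ultimately obtain i where "i \<in> I" "\<phi> z i \<noteq> \<phi> z' i"
    by (meson extensionalityI)
  moreover have "continuous_map Z euclideanreal (\<lambda>z. \<phi> z i)"
    using c \<open>i \<in> I\<close> by (simp add: continuous_map_componentwise)
  ultimately show ?thesis by blast
qed

lemma smallest_realcompactification_le:
  fixes T :: "'a topology" and Y :: "'b topology" and Z :: "'z topology"
  assumes Y: "smallest_realcompactification T L Y e"
    and Z: "realcompactification T Z k" and L: "\<forall>f\<in>L. extends_to T Z k f"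
  shows "realcompactification_le T Y e Z k"
proof -
  define ext where "ext g G \<longleftrightarrow> continuous_map Z euclideanreal G \<and> (\<forall>x\<in>topspace T. G (k x) = g x)"
    for g G
  define \<psi> where "\<psi> z = (\<lambda>g. (SOME G. ext g G) z)" for z
  have rc: "realcompact_space Z" and emb: "embedding_map T Z k"
    and dense: "Z closure_of (k ` topspace T) = topspace Z"
    using Z unfolding realcompactification_def by auto
  have kT: "k ` topspace T \<subseteq> topspace Z"
    using homeomorphic_imp_surjective_map[OF emb[unfolded embedding_map_def]]
    unfolding topspace_subtopology by blast
  have inj: "inj_on \<psi> (topspace Z)"
  proof (rule inj_onI, rule ccontr)
    fix z z' assume z: "z \<in> topspace Z" "z' \<in> topspace Z" "\<psi> z = \<psi> z'" "z \<noteq> z'"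
    then obtain G where G: "continuous_map Z euclideanreal G" "G z \<noteq> G z'"
      using realcompact_space_separates[OF rc] by blast
    let ?G = "SOME G'. ext (G \<circ> k) G'"
    have "ext (G \<circ> k) G" using G unfolding ext_def by auto
    then have ex: "ext (G \<circ> k) ?G" by (rule someI[of "ext (G \<circ> k)"])
    have eq: "?G y = G y" if y: "y \<in> topspace Z" for y
    proof (rule forall_in_closure_of_eq[where f = ?G and g = G])
      show "y \<in> Z closure_of (k ` topspace T)" using dense y by simp
      show "continuous_map Z euclideanreal ?G" using ex unfolding ext_def by blast
      show "?G x = G x" if "x \<in> k ` topspace T" for x
        using ex that unfolding ext_def by (metis (no_types, lifting) comp_apply imageE)
    qed (auto simp: G)
    have "?G z = ?G z'"
      using fun_cong[OF z(3), of "G \<circ> k"] unfolding \<psi>_def .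
    then show False
      using eq[OF z(1)] eq[OF z(2)] G(2) by argo
  qed
  define \<iota> where "\<iota> = inv_into (topspace Z) \<psi>"
  define Z' where "Z' = pullback_topology (\<psi> ` topspace Z) \<iota> Z"
  have \<iota>: "\<iota> (\<psi> z) = z" if "z \<in> topspace Z" for z
    using that inj by (simp add: \<iota>_def)
  have top: "topspace Z' = \<psi> ` topspace Z"
    unfolding Z'_def topspace_pullback_topology using \<iota> by auto
  have hm: "homeomorphic_maps Z Z' \<psi> \<iota>"
    unfolding homeomorphic_maps_def
  proof (intro conjI ballI)
    have "continuous_map Z Z (\<iota> \<circ> \<psi>)"
      by (rule continuous_map_eq[OF continuous_map_id]) (simp add: \<iota>)
    then show "continuous_map Z Z' \<psi>"
      unfolding Z'_def by (rule continuous_map_pullback') auto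
    show "continuous_map Z' Z \<iota>"
      using continuous_map_pullback[OF continuous_map_id, where A = "\<psi> ` topspace Z" and f = \<iota>]
      unfolding Z'_def by (simp only: id_o)
  qed (auto simp: \<iota> top)
  then have hZ: "homeomorphic_map Z Z' \<psi>"
    using homeomorphic_map_maps by blast
  have "realcompact_space Z'"
  proof (rule realcompact_space_homeomorphic[OF rc])
    show "Z' homeomorphic_space Z"
      unfolding homeomorphic_space_def using hm[THEN homeomorphic_maps_sym[THEN iffD1]] by blast
  qed
  moreover have "embedding_map T Z' (\<psi> \<circ> k)"
    by (rule embedding_map_compose[OF emb surjective_embedding_map[THEN iffD2, OF hZ, THEN conjunct1]])
  moreover have "Z' closure_of ((\<psi> \<circ> k) ` topspace T) = topspace Z'"
    using homeomorphic_map_closure_of[OF hZ kT] dense top by (simp only: image_comp)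
  moreover have "\<forall>f\<in>L. extends_to T Z' (\<psi> \<circ> k) f"
  proof
    fix f assume "f \<in> L"
    then obtain g where g: "continuous_map Z euclideanreal g" "\<forall>x\<in>topspace T. g (k x) = f x"
      using L unfolding extends_to_def by blast
    have "continuous_map Z' euclideanreal (g \<circ> \<iota>)"
      by (rule continuous_map_compose[OF _ g(1)]) (use hm in \<open>simp only: homeomorphic_maps_def\<close>)
    moreover have "(g \<circ> \<iota>) ((\<psi> \<circ> k) x) = f x" if "x \<in> topspace T" for x
    proof -
      have "k x \<in> topspace Z" using kT that by blast
      then show ?thesis using that g(2) by (simp add: \<iota>)
    qed
    ultimately show "extends_to T Z' (\<psi> \<circ> k) f"
      unfolding extends_to_def by blast
  qed
  ultimately have "realcompactification_le T Y e Z' (\<psi> \<circ> k)"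
    using Y unfolding smallest_realcompactification_def realcompactification_def by blast
  then obtain h where h: "continuous_map Z' Y h" "\<forall>x\<in>topspace T. h ((\<psi> \<circ> k) x) = e x"
    unfolding realcompactification_le_def by blast
  have "continuous_map Z Z' \<psi>"
    using hm unfolding homeomorphic_maps_def by (elim conjE)
  then have "continuous_map Z Y (h \<circ> \<psi>)"
    using h(1) by (rule continuous_map_compose)
  moreover have "\<forall>x\<in>topspace T. (h \<circ> \<psi>) (k x) = e x"
    using h(2) by (simp only: o_apply)
  ultimately show ?thesis
    unfolding realcompactification_le_def by blast
qed

end

theory Submission
  imports Defs
begin

text \<open>Write \<open>w\<mu>\<close> for the weak uniformity on \<open>X\<close> induced by the uniformly continuous real functions. It has
  an explicit base: the covers by sets \<open>{y. \<forall>u\<in>\<Phi>. \<bar>u y - u x\<bar> < \<epsilon>}\<close> with \<open>\<Phi>\<close> finite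
  (\<open>weak_uniformity_eq\<close>). Consequently a filter on \<open>X\<close> is \<open>w\<mu>\<close>-Cauchy if and only if every
  uniformly continuous real function has a limit along it (\<open>weak_Cauchy_filter_iff\<close>).

  Cauchy-continuous functions are continuous because neighbourhood filters are \<open>w\<mu>\<close>-Cauchy. For the
  converse, embed \<open>X\<close> by evaluation into the product of real lines indexed by the uniformly
  continuous functions. This is an embedding by a Urysohn lemma for uniform spaces
  (\<open>uniform_Urysohn\<close>), so the closure of the image is a realcompactification to which all
  uniformly continuous functions extend, and \<open>w\<mu>\<close>-Cauchy filters converge in it. By minimality it
  maps to the Samuel realcompactification over \<open>X\<close>. If the latter is equivalent to the Hewitt
  realcompactification, every continuous \<open>f\<close> extends to it and therefore to the closure of the
  image; so \<open>f\<close> has a limit along every \<open>w\<mu>\<close>-Cauchy filter (\<open>C_fun_subset_CC_fun\<close>).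

  In a metric space, uniformly continuous functions are bounded along Bourbaki-Cauchy filters, so
  every ultrafilter finer than such a filter is \<open>w\<mu>\<close>-Cauchy (\<open>ultrafilter_weak_Cauchy\<close>). For a
  Bourbaki-Cauchy sequence \<open>\<sigma>\<close> without cluster point, the reciprocal of
  \<open>inf\<^sub>n (d p (\<sigma> n) + 1/(n+1))\<close> is a continuous function of \<open>p\<close> that is unbounded along the sequence,
  hence not Cauchy-continuous. This settles sequences
  (\<open>Bourbaki_Cauchy_sequence_clusters\<close>); a Bourbaki-Cauchy filter is reduced to sequences that run
  through countably many of its members.\<close>

section \<open>Uniformly continuous functions separate points from closed sets\<close>

lemma covering_uniformityD:
  assumes "covering_uniformity X \<mu>"
  shows "\<mu> \<noteq> {}"
    and "\<And>\<U>. \<U> \<in> \<mu> \<Longrightarrow> cover_of X \<U>"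
    and "\<And>\<U> \<V>. \<U> \<in> \<mu> \<Longrightarrow> cover_of X \<V> \<Longrightarrow> refines \<U> \<V> \<Longrightarrow> \<V> \<in> \<mu>"
    and "\<And>\<U> \<V>. \<U> \<in> \<mu> \<Longrightarrow> \<V> \<in> \<mu> \<Longrightarrow> \<exists>\<W>\<in>\<mu>. refines \<W> \<U> \<and> refines \<W> \<V>"
    and "\<And>\<U>. \<U> \<in> \<mu> \<Longrightarrow> \<exists>\<V>\<in>\<mu>. star_refines \<V> \<U>"
    and "\<And>x y. x \<in> X \<Longrightarrow> y \<in> X \<Longrightarrow> x \<noteq> y \<Longrightarrow> \<exists>\<U>\<in>\<mu>. y \<notin> St {x} \<U>"
proof -
  note conj = assms[unfolded covering_uniformity_def]
  note c2 = conj[THEN conjunct2] note c3 = c2[THEN conjunct2]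
  note c4 = c3[THEN conjunct2] note c5 = c4[THEN conjunct2]
  show "\<mu> \<noteq> {}"
    by (rule conj[THEN conjunct1])
  show "cover_of X \<U>" if "\<U> \<in> \<mu>" for \<U>
    by (rule c2[THEN conjunct1, rule_format, OF that])
  show "\<V> \<in> \<mu>" if "\<U> \<in> \<mu>" "cover_of X \<V>" "refines \<U> \<V>" for \<U> \<V>
    by (rule c3[THEN conjunct1, rule_format, OF that(1) conjI[OF that(2,3)]])
  show "\<exists>\<W>\<in>\<mu>. refines \<W> \<U> \<and> refines \<W> \<V>" if "\<U> \<in> \<mu>" "\<V> \<in> \<mu>" for \<U> \<V>
    by (rule c4[THEN conjunct1, rule_format, OF that])
  show "\<exists>\<V>\<in>\<mu>. star_refines \<V> \<U>" if "\<U> \<in> \<mu>" for \<U>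
    by (rule c5[THEN conjunct1, rule_format, OF that])
  show "\<exists>\<U>\<in>\<mu>. y \<notin> St {x} \<U>" if "x \<in> X" "y \<in> X" "x \<noteq> y" for x y
    by (rule c5[THEN conjunct2, rule_format, OF that])
qed

lemma U_fun_iff:
  assumes "covering_uniformity X \<mu>"
  shows "f \<in> U_fun X \<mu> \<longleftrightarrow> (\<forall>\<epsilon>>0. \<exists>\<U>\<in>\<mu>. \<forall>U\<in>\<U>. \<forall>y\<in>U. \<forall>z\<in>U. \<bar>f y - f z\<bar> < \<epsilon>)"
proof (intro iffI allI impI)
  fix \<epsilon> :: real assume f: "f \<in> U_fun X \<mu>" and e: "\<epsilon> > 0"
  let ?V = "(\<lambda>x::real. ball x (\<epsilon>/2)) ` UNIV"
  have "?V \<in> real_uniformity"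
    using Met_TC.mballs_in_metric_uniformity[of "\<epsilon>/2", where 'a=real] e by simp
  then have "(\<lambda>V. f -` V \<inter> X) ` ?V \<in> \<mu>"
    using f unfolding U_fun_def unif_continuous_def by blast
  moreover have "\<bar>f y - f z\<bar> < \<epsilon>"
    if "U \<in> (\<lambda>V. f -` V \<inter> X) ` ?V" "y \<in> U" "z \<in> U" for U y z
  proof -
    obtain c where "dist c (f y) < \<epsilon>/2" "dist c (f z) < \<epsilon>/2" using \<open>U \<in> _\<close> \<open>y \<in> U\<close> \<open>z \<in> U\<close> by auto
    then show ?thesis using dist_triangle_half_r by (metis dist_real_def)
  qed
  ultimately show "\<exists>\<U>\<in>\<mu>. \<forall>U\<in>\<U>. \<forall>y\<in>U. \<forall>z\<in>U. \<bar>f y - f z\<bar> < \<epsilon>"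
    by (intro bexI[of _ "(\<lambda>V. f -` V \<inter> X) ` ?V"] ballI)
next
  assume *: "\<forall>\<epsilon>>0. \<exists>\<U>\<in>\<mu>. \<forall>U\<in>\<U>. \<forall>y\<in>U. \<forall>z\<in>U. \<bar>f y - f z\<bar> < \<epsilon>"
  have "(\<lambda>V. f -` V \<inter> X) ` \<V> \<in> \<mu>" if V: "\<V> \<in> real_uniformity" for \<V>
  proof -
    obtain \<epsilon> where e: "\<epsilon> > 0" "refines ((\<lambda>x. ball x \<epsilon>) ` UNIV) \<V>" and VC: "cover_of UNIV \<V>"
      using V unfolding metric_uniformity_def mem_Collect_eq mball_eq_ball by (elim conjE exE) (rule that)
    obtain \<U> where U: "\<U> \<in> \<mu>" "\<forall>U\<in>\<U>. \<forall>y\<in>U. \<forall>z\<in>U. \<bar>f y - f z\<bar> < \<epsilon>"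
      using *[rule_format, OF e(1)] by auto
    have sub: "U \<subseteq> X" if "U \<in> \<U>" for U
      using covering_uniformityD(2)[OF assms U(1)] that unfolding cover_of_def by auto
    have ball: "\<exists>V\<in>\<V>. ball c \<epsilon> \<subseteq> V" for c
      using e(2) unfolding refines_def by simp
    have "\<exists>V\<in>\<V>. U \<subseteq> f -` V \<inter> X" if UU: "U \<in> \<U>" for U
    proof (cases "U = {}")
      case True
      then show ?thesis using ball by auto
    next
      case False
      then obtain z where z: "z \<in> U" by auto
      obtain V where V: "V \<in> \<V>" "ball (f z) \<epsilon> \<subseteq> V" using ball[of "f z"] by auto
      have "f y \<in> ball (f z) \<epsilon>" if "y \<in> U" for y
        using U(2) UU z that by (simp add: dist_real_def)
      then have "U \<subseteq> f -` V \<inter> X" using V(2) sub[OF UU] by (simp add: subset_iff)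
      then show ?thesis using V(1) by (rule bexI)
    qed
    then have "refines \<U> ((\<lambda>V. f -` V \<inter> X) ` \<V>)" unfolding refines_def by simp
    moreover have "cover_of X ((\<lambda>V. f -` V \<inter> X) ` \<V>)"
      using VC unfolding cover_of_def by auto
    ultimately show ?thesis using covering_uniformityD(3)[OF assms U(1)] by blast
  qed
  then show "f \<in> U_fun X \<mu>" unfolding U_fun_def unif_continuous_def by blast
qed

text \<open>Two points are linked by a cover if some member of the cover contains both.\<close>

definition linked :: "'a set set \<Rightarrow> 'a \<Rightarrow> 'a \<Rightarrow> bool"
  where "linked \<U> x y \<longleftrightarrow> (\<exists>U\<in>\<U>. x \<in> U \<and> y \<in> U)"

lemma linked_sym: "linked \<U> x y \<Longrightarrow> linked \<U> y x"
  unfolding linked_def by blast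

lemma linked_star_refines:
  assumes "star_refines \<V> \<U>" "linked \<V> p q" "linked \<V> q r" "linked \<V> r s"
  shows "linked \<U> p s"
proof -
  obtain A B C where "A \<in> \<V>" "B \<in> \<V>" "C \<in> \<V>" "p \<in> A" "q \<in> A" "q \<in> B" "r \<in> B" "r \<in> C" "s \<in> C"
    using assms(2-4) unfolding linked_def by (elim bexE conjE) (rule that)
  then have "p \<in> St B \<V>" "s \<in> St B \<V>" "B \<in> \<V>" unfolding St_def by auto
  moreover then obtain U where "U \<in> \<U>" "St B \<V> \<subseteq> U"
    using assms(1) unfolding star_refines_def refines_def by auto
  ultimately show ?thesis unfolding linked_def by auto
qed

text \<open>A chain from \<open>x\<close> to \<open>y\<close> along a sequence of covers \<open>u\<close>: the list records, step by step, the index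
  of the cover that links a point to the next one.\<close>

primrec chained :: "(nat \<Rightarrow> 'a set set) \<Rightarrow> nat list \<Rightarrow> 'a \<Rightarrow> 'a \<Rightarrow> bool" where
  "chained u [] x y \<longleftrightarrow> x = y"
| "chained u (n # ns) x y \<longleftrightarrow> (\<exists>z. linked (u n) x z \<and> chained u ns z y)"

lemma chained_append: "chained u (as @ bs) x y \<longleftrightarrow> (\<exists>z. chained u as x z \<and> chained u bs z y)"
  by (induction as arbitrary: x) (simp_all, blast)

text \<open>The length of a chain, where a step through the cover \<open>u n\<close> has length \<open>2\<^sup>-\<^sup>n\<close>.\<close>

definition weight :: "nat list \<Rightarrow> real"
  where "weight ns = (\<Sum>n\<leftarrow>ns. (1/2)^n)"

lemma weight_simps [simp]:
  "weight [] = 0" "weight (n # ns) = (1/2)^n + weight ns" "weight (as @ bs) = weight as + weight bs"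
  by (simp_all add: weight_def)

lemma weight_nonneg: "0 \<le> weight ns"
  by (induction ns) simp_all

text \<open>A chain longer than \<open>t\<close> has a first step \<open>m\<close> that carries the accumulated length beyond \<open>t\<close>.\<close>

lemma weight_split:
  assumes "0 \<le> t" "t < weight ns"
  shows "\<exists>as m bs. ns = as @ m # bs \<and> weight as \<le> t \<and> t < weight (as @ [m])"
  using assms
proof (induction ns arbitrary: t)
  case (Cons n ns)
  show ?case
  proof (cases "t < (1/2)^n")
    case True
    then have "n # ns = [] @ n # ns \<and> weight [] \<le> t \<and> t < weight ([] @ [n])"
      using Cons.prems by simp
    then show ?thesis by blast
  next
    case False
    then obtain as m bs where "ns = as @ m # bs" "weight as \<le> t - (1/2)^n" "t - (1/2)^n < weight (as @ [m])"
      using Cons.IH[of "t - (1/2)^n"] Cons.prems by auto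
    then have "n # ns = (n # as) @ m # bs \<and> weight (n # as) \<le> t \<and> t < weight ((n # as) @ [m])"
      by simp
    then show ?thesis by blast
  qed
qed simp

text \<open>The chain lemma behind the metrization of uniformities with a countable base: if each cover
  star-refines the preceding one, a chain shorter than \<open>2\<^sup>-\<^sup>n\<close> can be replaced by a single
  link in \<open>u n\<close>. The chain is cut at the step where half of its length is passed; the two
  remaining pieces are shorter than \<open>2\<^sup>-\<^sup>n\<^sup>-\<^sup>1\<close>, so that by induction they and the middle step are
  links in \<open>u (Suc n)\<close>, and three such links make a link in \<open>u n\<close>.\<close>

lemma linked_of_chained:
  assumes cover: "\<And>n. cover_of X (u n)"
    and star: "\<And>n. star_refines (u (Suc n)) (u n)"
    and "chained u ns x y" "x \<in> X" "weight ns < (1/2)^n"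
  shows "linked (u n) x y"
  using assms(3-)
proof (induction ns arbitrary: n x y rule: length_induct)
  case (1 ns)
  have refl: "linked (u k) z z" if "z \<in> X" for k z
    using cover[of k] that unfolding linked_def cover_of_def by blast
  have linkedX: "z \<in> X" if "linked (u k) w z" for k w z
    using cover[of k] that unfolding linked_def cover_of_def by blast
  have chainX: "z \<in> X" if "chained u as w z" "w \<in> X" for as w z
    using that by (induction as arbitrary: w) (auto dest: linkedX)
  show ?case
  proof (cases "ns = []")
    case True
    then show ?thesis using 1 refl by simp
  next
    case False
    have "0 < weight ns"
      using False by (cases ns) (auto intro: add_pos_nonneg weight_nonneg)
    then obtain as m bs where ns: "ns = as @ m # bs"
      and as: "weight as \<le> weight ns / 2" and m: "weight ns / 2 < weight (as @ [m])"
      using weight_split[of "weight ns / 2" ns] by auto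
    obtain p q where p: "chained u as x p" and q: "linked (u m) p q" and y: "chained u bs q y"
      using "1.prems"(1) unfolding ns chained_append by auto
    have wn: "(1/2::real)^m \<le> weight ns"
      using weight_nonneg[of as] weight_nonneg[of bs] unfolding ns by simp
    have "(1/2::real)^m < (1/2)^n" using wn "1.prems"(3) by (rule le_less_trans)
    moreover have "(1/2::real)^n \<le> (1/2)^m" if "m \<le> n" using that by (intro power_decreasing) auto
    ultimately have "n < m" by (meson not_less)
    have X: "p \<in> X" "q \<in> X" using p q "1.prems"(2) chainX linkedX by blast+
    have bs: "weight bs \<le> weight ns / 2" using m unfolding ns by simp
    have A: "linked (u (Suc n)) x p"
      using "1.IH"[rule_format, of as x p "Suc n"] as p "1.prems" ns by simp
    have B: "linked (u (Suc n)) q y"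
      using "1.IH"[rule_format, of bs q y "Suc n"] bs y X "1.prems" ns by simp
    have sr: "\<exists>U\<in>u k. V \<subseteq> U" if V: "V \<in> u (Suc k)" for k V
    proof -
      have "V \<subseteq> St V (u (Suc k))" using V unfolding St_def by blast
      moreover obtain U where "U \<in> u k" "St V (u (Suc k)) \<subseteq> U"
        using star[of k] V unfolding star_refines_def refines_def by auto
      ultimately show ?thesis by (meson order_trans)
    qed
    have "linked (u (Suc n)) p q"
      using \<open>n < m\<close>[THEN Suc_leI] q
    proof (induction rule: dec_induct)
      case (step k)
      then show ?case using sr unfolding linked_def by (meson subsetD)
    qed
    then show ?thesis using linked_star_refines[OF star A _ B] by blast
  qed
qed

text \<open>The function is the distance to \<open>x\<close>, truncated at 1, where distance means the infimum of the
  lengths of chains. A link in \<open>u n\<close> changes it by at most \<open>2\<^sup>-\<^sup>n\<close>, which gives uniform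
  continuity; by the chain lemma no chain shorter than 1 leads out of the star of \<open>x\<close>.\<close>

lemma uniform_Urysohn:
  assumes \<mu>: "covering_uniformity X \<mu>" and x: "x \<in> X" and \<U>: "\<U> \<in> \<mu>"
  shows "\<exists>f\<in>U_fun X \<mu>. f x = 0 \<and> (\<forall>y. y \<notin> St {x} \<U> \<longrightarrow> f y = 1)"
proof -
  obtain u where u: "\<And>n. u n \<in> \<mu>" and u0: "u 0 = \<U>"
    and star: "\<And>n. star_refines (u (Suc n)) (u n)"
  proof -
    have "\<exists>u. \<forall>n. (u n \<in> \<mu> \<and> (n = 0 \<longrightarrow> u n = \<U>)) \<and> star_refines (u (Suc n)) (u n)"
      by (rule dependent_nat_choice) (use \<U> covering_uniformityD(5)[OF \<mu>] in auto)
    then show ?thesis using that by blast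
  qed
  have cover: "cover_of X (u n)" for n using covering_uniformityD(2)[OF \<mu> u] .
  \<comment> \<open>The element 1 truncates the distance and covers the points that no chain reaches.\<close>
  define S where "S y = insert 1 {weight ns | ns. chained u ns x y}" for y
  define f where "f y = Inf (S y)" for y
  have bdd: "bdd_below (S y)" for y
    by (rule bdd_belowI[of _ 0]) (auto simp: S_def weight_nonneg)
  have ne: "S y \<noteq> {}" for y by (simp add: S_def)
  have step: "f z \<le> f y + (1/2)^n" if l: "linked (u n) y z" for y z n
  proof -
    have "f z - (1/2)^n \<le> s" if "s \<in> S y" for s
    proof -
      have "f z \<le> s + (1/2)^n"
      proof (cases "s = 1")
        case True
        have "f z \<le> 1" unfolding f_def by (rule cInf_lower[OF _ bdd]) (simp add: S_def)
        then show ?thesis using True by (simp add: add_increasing2)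
      next
        case False
        then obtain ns where ns: "chained u ns x y" "s = weight ns"
          using \<open>s \<in> S y\<close> unfolding S_def by blast
        then have "chained u (ns @ [n]) x z" using l by (auto simp: chained_append)
        moreover have "weight (ns @ [n]) = s + (1/2)^n" using ns by simp
        ultimately have "s + (1/2)^n \<in> S z" unfolding S_def by (metis (mono_tags, lifting) insertCI mem_Collect_eq)
        then show ?thesis unfolding f_def by (rule cInf_lower[OF _ bdd])
      qed
      then show ?thesis by simp
    qed
    then have "f z - (1/2)^n \<le> f y" unfolding f_def[of y] by (rule cInf_greatest[OF ne])
    then show ?thesis by simp
  qed
  have "f \<in> U_fun X \<mu>"
    unfolding U_fun_iff[OF \<mu>]
  proof (intro allI impI)
    fix \<epsilon> :: real assume "\<epsilon> > 0"
    then obtain n where n: "(1/2)^n < \<epsilon>" using real_arch_pow_inv[of \<epsilon> "1/2"] by auto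
    have "\<bar>f y - f z\<bar> < \<epsilon>" if "U \<in> u n" "y \<in> U" "z \<in> U" for U y z
    proof -
      have "linked (u n) y z" using that unfolding linked_def by blast
      then show ?thesis using step[of n y z] step[of n z y] linked_sym n by fastforce
    qed
    then show "\<exists>\<U>\<in>\<mu>. \<forall>U\<in>\<U>. \<forall>y\<in>U. \<forall>z\<in>U. \<bar>f y - f z\<bar> < \<epsilon>" using u[of n] by blast
  qed
  moreover have "f x = 0"
  proof (rule antisym)
    have "chained u [] x x" by simp
    then have "0 \<in> S x" unfolding S_def using weight_simps(1) by (metis (mono_tags, lifting) insertCI mem_Collect_eq)
    then show "f x \<le> 0" unfolding f_def by (rule cInf_lower[OF _ bdd])
    show "0 \<le> f x" unfolding f_def
      by (rule cInf_greatest[OF ne]) (auto simp: S_def weight_nonneg)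
  qed
  moreover have "f y = 1" if y: "y \<notin> St {x} \<U>" for y
  proof (rule antisym)
    show "f y \<le> 1" unfolding f_def by (rule cInf_lower[OF _ bdd]) (simp add: S_def)
    have "1 \<le> weight ns" if "chained u ns x y" for ns
    proof (rule ccontr)
      assume "\<not> 1 \<le> weight ns"
      then have "linked (u 0) x y" using linked_of_chained[OF cover star that x, of 0] by simp
      then show False using y u0 unfolding linked_def St_def by blast
    qed
    then show "1 \<le> f y" unfolding f_def
      by (intro cInf_greatest[OF ne]) (auto simp: S_def)
  qed
  ultimately show ?thesis by blast
qed

section \<open>The weak uniformity and its Cauchy filters\<close>

lemma real_Cauchy_filter_iff:
  fixes f :: "'a \<Rightarrow> real"
  shows "Cauchy_filter_on UNIV real_uniformity (filtermap f F) \<longleftrightarrow> F \<noteq> bot \<and> (\<exists>l. (f \<longlongrightarrow> l) F)"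
proof (intro iffI conjI)
  assume C: "Cauchy_filter_on UNIV real_uniformity (filtermap f F)"
  then show nb: "F \<noteq> bot"
    unfolding Cauchy_filter_on_def filter_on_def by (simp add: filtermap_bot_iff)
  have "\<exists>P. eventually P F \<and> (\<forall>x y. P x \<and> P y \<longrightarrow> dist (f x) (f y) < e)" if "e > 0" for e
  proof -
    have "(\<lambda>c::real. ball c (e/2)) ` UNIV \<in> real_uniformity"
      using Met_TC.mballs_in_metric_uniformity[of "e/2", where 'a=real] \<open>e > 0\<close> by simp
    then have "\<exists>B\<in>(\<lambda>c::real. ball c (e/2)) ` UNIV. \<forall>\<^sub>F r in filtermap f F. r \<in> B"
      using C unfolding Cauchy_filter_on_def by (elim conjE) (rule bspec)
    then obtain c where "\<forall>\<^sub>F r in filtermap f F. r \<in> ball c (e/2)"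
      by auto
    then have "\<forall>\<^sub>F x in F. dist c (f x) < e/2"
      unfolding eventually_filtermap mem_ball .
    then show ?thesis using dist_triangle_half_r by (intro exI conjI) auto
  qed
  then have "cauchy_filter (filtermap f F)"
    unfolding cauchy_filter_metric_filtermap by simp
  then have "\<exists>l. filtermap f F \<le> nhds l"
    using nb by (intro cauchy_filter_complete_converges[OF _ complete_UNIV]) (simp_all add: filtermap_bot_iff)
  then show "\<exists>l. (f \<longlongrightarrow> l) F" unfolding filterlim_def by auto
next
  assume "F \<noteq> bot \<and> (\<exists>l. (f \<longlongrightarrow> l) F)"
  then obtain l where nb: "F \<noteq> bot" and l: "(f \<longlongrightarrow> l) F" by auto
  show "Cauchy_filter_on UNIV real_uniformity (filtermap f F)"
    unfolding Cauchy_filter_on_def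
  proof (intro conjI ballI)
    show "filter_on UNIV (filtermap f F)"
      using nb by (simp add: filter_on_def filtermap_bot_iff)
    fix \<V> :: "real set set" assume "\<V> \<in> real_uniformity"
    then obtain \<epsilon> where e: "\<epsilon> > 0" "refines ((\<lambda>x. ball x \<epsilon>) ` UNIV) \<V>"
      unfolding metric_uniformity_def mem_Collect_eq mball_eq_ball by (elim conjE exE) (rule that)
    then obtain V where V: "V \<in> \<V>" "ball l \<epsilon> \<subseteq> V" unfolding refines_def by auto
    have "\<forall>\<^sub>F x in F. f x \<in> V"
      using tendstoD[OF l e(1)] by eventually_elim (use V in \<open>auto simp: dist_commute\<close>)
    then show "\<exists>V\<in>\<V>. \<forall>\<^sub>F r in filtermap f F. r \<in> V"
      using V(1) by (auto simp: eventually_filtermap)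
  qed
qed

lemma Cauchy_filter_on_filtermap:
  assumes F: "Cauchy_filter_on X \<nu> F" and f: "unif_continuous X \<nu> Y \<kappa> f"
  shows "Cauchy_filter_on Y \<kappa> (filtermap f F)"
  unfolding Cauchy_filter_on_def
proof (intro conjI ballI)
  have FX: "F \<noteq> bot" "\<forall>\<^sub>F x in F. x \<in> X"
    using F unfolding Cauchy_filter_on_def filter_on_def le_principal by auto
  have "\<forall>\<^sub>F x in F. f x \<in> Y"
    using FX(2) by eventually_elim (use f in \<open>auto simp: unif_continuous_def\<close>)
  then show "filter_on Y (filtermap f F)"
    using FX(1) unfolding filter_on_def le_principal by (simp add: filtermap_bot_iff eventually_filtermap)
  fix \<V> assume "\<V> \<in> \<kappa>"
  then have "(\<lambda>V. f -` V \<inter> X) ` \<V> \<in> \<nu>" using f unfolding unif_continuous_def by auto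
  then have "\<exists>U\<in>(\<lambda>V. f -` V \<inter> X) ` \<V>. \<forall>\<^sub>F x in F. x \<in> U"
    using F unfolding Cauchy_filter_on_def by (elim conjE) (rule bspec)
  then obtain V where "V \<in> \<V>" "\<forall>\<^sub>F x in F. x \<in> f -` V \<inter> X" by auto
  then show "\<exists>V\<in>\<V>. \<forall>\<^sub>F y in filtermap f F. y \<in> V"
    unfolding eventually_filtermap by (intro bexI[of _ V]) (auto elim: eventually_mono)
qed

text \<open>The basic cover determined by a set \<open>\<Phi>\<close> of functions and a radius: the balls of the pseudometric
  \<open>sup {\<bar>u x - u y\<bar> | u. u \<in> \<Phi>}\<close>, for finite \<open>\<Phi>\<close>.\<close>

definition initial_cover :: "'a set \<Rightarrow> ('a \<Rightarrow> real) set \<Rightarrow> real \<Rightarrow> 'a set set"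
  where "initial_cover X \<Phi> \<epsilon> = (\<lambda>x. {y \<in> X. \<forall>u\<in>\<Phi>. \<bar>u y - u x\<bar> < \<epsilon>}) ` X"

text \<open>The covers refined by a basic cover for finitely many functions of \<open>L\<close>. For a nonempty \<open>X\<close> this is
  the weakest uniformity making the members of \<open>L\<close> uniformly continuous. For empty \<open>X\<close> it is not:
  it then also contains the empty cover, which the weakest uniformity does not.\<close>

definition initial_uniformity :: "'a set \<Rightarrow> ('a \<Rightarrow> real) set \<Rightarrow> 'a set set set"
  where "initial_uniformity X L =
    {\<U>. cover_of X \<U> \<and> (\<exists>\<Phi> \<epsilon>. finite \<Phi> \<and> \<Phi> \<subseteq> L \<and> \<epsilon> > 0 \<and> refines (initial_cover X \<Phi> \<epsilon>) \<U>)}"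

lemma refines_refl: "refines \<U> \<U>"
  unfolding refines_def by auto

lemma refines_trans: "refines \<U> \<V> \<Longrightarrow> refines \<V> \<W> \<Longrightarrow> refines \<U> \<W>"
  unfolding refines_def by (meson order_trans)

lemma initial_uniformityI:
  assumes "cover_of X \<U>" "finite \<Phi>" "\<Phi> \<subseteq> L" "\<epsilon> > 0" "refines (initial_cover X \<Phi> \<epsilon>) \<U>"
  shows "\<U> \<in> initial_uniformity X L"
  unfolding initial_uniformity_def mem_Collect_eq using assms by (intro conjI exI)

lemma initial_uniformityE:
  assumes "\<U> \<in> initial_uniformity X L"
  obtains \<Phi> \<epsilon> where "cover_of X \<U>" "finite \<Phi>" "\<Phi> \<subseteq> L" "\<epsilon> > 0" "refines (initial_cover X \<Phi> \<epsilon>) \<U>"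
  using assms unfolding initial_uniformity_def mem_Collect_eq by (elim conjE exE) (rule that)

lemma initial_cover_in_initial_uniformity:
  assumes "finite \<Phi>" "\<Phi> \<subseteq> L" "\<epsilon> > 0"
  shows "initial_cover X \<Phi> \<epsilon> \<in> initial_uniformity X L"
proof (rule initial_uniformityI[OF _ assms refines_refl])
  show "cover_of X (initial_cover X \<Phi> \<epsilon>)"
    using assms(3) unfolding cover_of_def initial_cover_def by auto
qed

lemma initial_cover_mono:
  assumes "\<Phi> \<subseteq> \<Psi>" "\<delta> \<le> \<epsilon>"
  shows "refines (initial_cover X \<Psi> \<delta>) (initial_cover X \<Phi> \<epsilon>)"
  unfolding refines_def initial_cover_def ball_simps bex_simps
proof (intro ballI bexI)
  fix x assume "x \<in> X"
  show "{y \<in> X. \<forall>u\<in>\<Psi>. \<bar>u y - u x\<bar> < \<delta>} \<subseteq> {y \<in> X. \<forall>u\<in>\<Phi>. \<bar>u y - u x\<bar> < \<epsilon>}"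
    using assms by fastforce
qed

text \<open>Separation of points by \<open>L\<close> is what makes the uniformity Hausdorff.\<close>

lemma covering_uniformity_initial:
  assumes "X \<noteq> {}" and sep: "\<And>x y. x \<in> X \<Longrightarrow> y \<in> X \<Longrightarrow> x \<noteq> y \<Longrightarrow> \<exists>u\<in>L. u x \<noteq> u y"
  shows "covering_uniformity X (initial_uniformity X L)"
  unfolding covering_uniformity_def
proof (intro conjI ballI allI impI)
  show "initial_uniformity X L \<noteq> {}"
    using initial_cover_in_initial_uniformity[of "{}" L 1 X] by auto
next
  fix \<U> assume "\<U> \<in> initial_uniformity X L"
  then show "cover_of X \<U>" by (rule initial_uniformityE)
next
  fix \<U> \<V> assume "\<U> \<in> initial_uniformity X L" "cover_of X \<V> \<and> refines \<U> \<V>"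
  then show "\<V> \<in> initial_uniformity X L"
    by (elim initial_uniformityE conjE) (rule initial_uniformityI, auto intro: refines_trans)
next
  fix \<U> \<V> assume U: "\<U> \<in> initial_uniformity X L" and V: "\<V> \<in> initial_uniformity X L"
  obtain \<Phi> \<epsilon> where 1: "finite \<Phi>" "\<Phi> \<subseteq> L" "\<epsilon> > 0" "refines (initial_cover X \<Phi> \<epsilon>) \<U>"
    using U by (rule initial_uniformityE)
  obtain \<Psi> \<delta> where 2: "finite \<Psi>" "\<Psi> \<subseteq> L" "\<delta> > 0" "refines (initial_cover X \<Psi> \<delta>) \<V>"
    using V by (rule initial_uniformityE)
  let ?W = "initial_cover X (\<Phi> \<union> \<Psi>) (min \<epsilon> \<delta>)"
  have "?W \<in> initial_uniformity X L"
    using 1 2 by (intro initial_cover_in_initial_uniformity) auto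
  moreover have "refines ?W \<U>" "refines ?W \<V>"
    using refines_trans[OF initial_cover_mono 1(4), of "\<Phi> \<union> \<Psi>" "min \<epsilon> \<delta>"]
      refines_trans[OF initial_cover_mono 2(4), of "\<Phi> \<union> \<Psi>" "min \<epsilon> \<delta>"] by auto
  ultimately show "\<exists>\<W>\<in>initial_uniformity X L. refines \<W> \<U> \<and> refines \<W> \<V>" by (intro bexI conjI)
next
  fix \<U> assume U: "\<U> \<in> initial_uniformity X L"
  obtain \<Phi> \<epsilon> where 1: "finite \<Phi>" "\<Phi> \<subseteq> L" "\<epsilon> > 0" "refines (initial_cover X \<Phi> \<epsilon>) \<U>"
    using U by (rule initial_uniformityE)
  let ?N = "\<lambda>x r. {y \<in> X. \<forall>u\<in>\<Phi>. \<bar>u y - u x\<bar> < r}"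
  let ?V = "initial_cover X \<Phi> (\<epsilon>/3)"
  have "St (?N x (\<epsilon>/3)) ?V \<subseteq> ?N x \<epsilon>" if "x \<in> X" for x
  proof
    fix y assume "y \<in> St (?N x (\<epsilon>/3)) ?V"
    then obtain z w where zw: "w \<in> ?N x (\<epsilon>/3)" "w \<in> ?N z (\<epsilon>/3)" "y \<in> ?N z (\<epsilon>/3)"
      unfolding St_def initial_cover_def by auto
    have "\<bar>u y - u x\<bar> < \<epsilon>" if "u \<in> \<Phi>" for u
    proof -
      have "\<bar>u w - u x\<bar> < \<epsilon>/3" "\<bar>u w - u z\<bar> < \<epsilon>/3" "\<bar>u y - u z\<bar> < \<epsilon>/3" using zw that by auto
      then show ?thesis by linarith
    qed
    then show "y \<in> ?N x \<epsilon>" using zw by simp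
  qed
  then have "refines ((\<lambda>V. St V ?V) ` ?V) (initial_cover X \<Phi> \<epsilon>)"
    unfolding refines_def initial_cover_def[of X \<Phi> \<epsilon>] initial_cover_def[of X \<Phi> "\<epsilon>/3"] image_image
      ball_simps bex_simps by (intro ballI bexI)
  then have "star_refines ?V \<U>"
    unfolding star_refines_def using 1(4) by (rule refines_trans)
  moreover have "?V \<in> initial_uniformity X L"
    using 1 by (intro initial_cover_in_initial_uniformity) auto
  ultimately show "\<exists>\<V>\<in>initial_uniformity X L. star_refines \<V> \<U>" by (intro bexI)
next
  fix x y assume xy: "x \<in> X" "y \<in> X" "x \<noteq> y"
  then obtain u where u: "u \<in> L" "u x \<noteq> u y" using sep by auto
  let ?r = "\<bar>u x - u y\<bar> / 2"
  have "y \<notin> St {x} (initial_cover X {u} ?r)"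
  proof
    assume "y \<in> St {x} (initial_cover X {u} ?r)"
    then obtain z where "\<bar>u x - u z\<bar> < ?r" "\<bar>u y - u z\<bar> < ?r"
      unfolding St_def initial_cover_def by auto
    moreover have "\<bar>u x - u y\<bar> \<le> \<bar>u x - u z\<bar> + \<bar>u y - u z\<bar>" by linarith
    ultimately show False by argo
  qed
  moreover have "initial_cover X {u} ?r \<in> initial_uniformity X L"
    using u by (intro initial_cover_in_initial_uniformity) auto
  ultimately show "\<exists>\<U>\<in>initial_uniformity X L. y \<notin> St {x} \<U>" by (intro bexI)
qed

lemma initial_uniformity_least:
  assumes "X \<noteq> {}" and \<nu>: "covering_uniformity X \<nu>" and L: "L \<subseteq> U_fun X \<nu>"
  shows "initial_uniformity X L \<subseteq> \<nu>"
proof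
  fix \<U> assume "\<U> \<in> initial_uniformity X L"
  then obtain \<Phi> \<epsilon> where \<U>: "cover_of X \<U>" "finite \<Phi>" "\<Phi> \<subseteq> L" "\<epsilon> > 0" "refines (initial_cover X \<Phi> \<epsilon>) \<U>"
    by (rule initial_uniformityE)
  have "\<exists>\<V>\<in>\<nu>. \<forall>V\<in>\<V>. \<forall>y\<in>V. \<forall>z\<in>V. \<forall>u\<in>\<Phi>. \<bar>u y - u z\<bar> < \<epsilon>"
    using \<U>(2,3)
  proof (induction \<Phi>)
    case empty
    then show ?case using covering_uniformityD(1)[OF \<nu>] by auto
  next
    case (insert u \<Phi>)
    obtain \<V> where V: "\<V> \<in> \<nu>" "\<forall>V\<in>\<V>. \<forall>y\<in>V. \<forall>z\<in>V. \<forall>u\<in>\<Phi>. \<bar>u y - u z\<bar> < \<epsilon>"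
      using insert by auto
    have "u \<in> U_fun X \<nu>" using insert.prems L by auto
    then obtain \<V>' where V': "\<V>' \<in> \<nu>" "\<forall>V\<in>\<V>'. \<forall>y\<in>V. \<forall>z\<in>V. \<bar>u y - u z\<bar> < \<epsilon>"
      using \<U>(4) unfolding U_fun_iff[OF \<nu>] by auto
    obtain \<W> where W: "\<W> \<in> \<nu>" "refines \<W> \<V>" "refines \<W> \<V>'"
      using covering_uniformityD(4)[OF \<nu> V(1) V'(1)] by auto
    have "\<bar>v y - v z\<bar> < \<epsilon>" if "W \<in> \<W>" "y \<in> W" "z \<in> W" "v \<in> insert u \<Phi>" for W y z v
    proof -
      obtain A B where "A \<in> \<V>" "W \<subseteq> A" "B \<in> \<V>'" "W \<subseteq> B"
        using W(2,3) \<open>W \<in> \<W>\<close> unfolding refines_def by meson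
      then have "y \<in> A" "z \<in> A" "y \<in> B" "z \<in> B" using \<open>y \<in> W\<close> \<open>z \<in> W\<close> by auto
      then show ?thesis using V(2) V'(2) \<open>A \<in> \<V>\<close> \<open>B \<in> \<V>'\<close> \<open>v \<in> insert u \<Phi>\<close> by auto
    qed
    then show ?case using W(1) by (intro bexI[of _ \<W>]) auto
  qed
  then obtain \<V> where V: "\<V> \<in> \<nu>" and osc: "\<And>V y z u. V \<in> \<V> \<Longrightarrow> y \<in> V \<Longrightarrow> z \<in> V \<Longrightarrow> u \<in> \<Phi> \<Longrightarrow> \<bar>u y - u z\<bar> < \<epsilon>"
    by auto
  have "\<exists>B\<in>initial_cover X \<Phi> \<epsilon>. A \<subseteq> B" if A: "A \<in> \<V>" for A
  proof (cases "A = {}")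
    case True
    then show ?thesis using \<open>X \<noteq> {}\<close> by (auto simp: initial_cover_def)
  next
    case False
    then obtain x where x: "x \<in> A" by auto
    have "A \<subseteq> X" using covering_uniformityD(2)[OF \<nu> V] A unfolding cover_of_def by auto
    then have "A \<subseteq> {y \<in> X. \<forall>u\<in>\<Phi>. \<bar>u y - u x\<bar> < \<epsilon>}" "x \<in> X" using osc[OF A _ x] x by auto
    then show ?thesis unfolding initial_cover_def by auto
  qed
  then have "refines \<V> (initial_cover X \<Phi> \<epsilon>)" unfolding refines_def by auto
  then show "\<U> \<in> \<nu>"
    by (rule covering_uniformityD(3)[OF \<nu> V \<U>(1) refines_trans[OF _ \<U>(5)]])
qed

lemma U_fun_separates:
  assumes \<mu>: "covering_uniformity X \<mu>" and "x \<in> X" "y \<in> X" "x \<noteq> y"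
  shows "\<exists>u\<in>U_fun X \<mu>. u x \<noteq> u y"
proof -
  obtain \<U> where "\<U> \<in> \<mu>" "y \<notin> St {x} \<U>" using covering_uniformityD(6)[OF assms] by auto
  then obtain u where "u \<in> U_fun X \<mu>" "u x = 0" "u y = 1"
    using uniform_Urysohn[OF \<mu> \<open>x \<in> X\<close>] by metis
  then show ?thesis by (intro bexI[of _ u]) auto
qed

text \<open>The explicit base shows that the least element in the definition of the weak uniformity exists.\<close>

lemma weak_uniformity_eq:
  assumes \<mu>: "covering_uniformity X \<mu>" and "X \<noteq> {}"
  shows "weak_uniformity X \<mu> = initial_uniformity X (U_fun X \<mu>)"
    and "U_fun X \<mu> \<subseteq> U_fun X (weak_uniformity X \<mu>)"
proof -
  let ?W = "initial_uniformity X (U_fun X \<mu>)"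
  have W: "covering_uniformity X ?W"
    by (rule covering_uniformity_initial[OF \<open>X \<noteq> {}\<close> U_fun_separates[OF \<mu>]])
  have U: "U_fun X \<mu> \<subseteq> U_fun X ?W"
  proof
    fix f assume f: "f \<in> U_fun X \<mu>"
    show "f \<in> U_fun X ?W"
      unfolding U_fun_iff[OF W]
    proof (intro allI impI)
      fix \<epsilon> :: real assume e: "\<epsilon> > 0"
      have "initial_cover X {f} (\<epsilon>/2) \<in> ?W"
        using f e by (intro initial_cover_in_initial_uniformity) auto
      moreover have "\<bar>f y - f z\<bar> < \<epsilon>" if U: "U \<in> initial_cover X {f} (\<epsilon>/2)" "y \<in> U" "z \<in> U" for U y z
      proof -
        obtain x where "\<bar>f y - f x\<bar> < \<epsilon>/2" "\<bar>f z - f x\<bar> < \<epsilon>/2"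
          using U unfolding initial_cover_def by auto
        then show ?thesis by linarith
      qed
      ultimately show "\<exists>\<U>\<in>?W. \<forall>U\<in>\<U>. \<forall>y\<in>U. \<forall>z\<in>U. \<bar>f y - f z\<bar> < \<epsilon>" by (intro bexI ballI)
    qed
  qed
  show eq: "weak_uniformity X \<mu> = ?W"
    unfolding weak_uniformity_def
  proof (rule Least_equality)
    show "covering_uniformity X ?W \<and> (\<forall>f\<in>U_fun X \<mu>. unif_continuous X ?W UNIV real_uniformity f)"
      using W U unfolding U_fun_def by auto
    show "?W \<le> \<nu>" if "covering_uniformity X \<nu> \<and> (\<forall>f\<in>U_fun X \<mu>. unif_continuous X \<nu> UNIV real_uniformity f)" for \<nu>
      using that initial_uniformity_least[OF \<open>X \<noteq> {}\<close>, of \<nu> "U_fun X \<mu>"] unfolding U_fun_def[of X \<nu>] by auto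
  qed
  show "U_fun X \<mu> \<subseteq> U_fun X (weak_uniformity X \<mu>)"
    using U unfolding eq .
qed

text \<open>This holds for empty \<open>X\<close> as well, because there is then no proper filter on \<open>X\<close>.\<close>

lemma weak_Cauchy_filter_iff:
  assumes \<mu>: "covering_uniformity X \<mu>"
  shows "Cauchy_filter_on X (weak_uniformity X \<mu>) F \<longleftrightarrow>
    filter_on X F \<and> (\<forall>u\<in>U_fun X \<mu>. \<exists>l. (u \<longlongrightarrow> l) F)"
proof (intro iffI conjI ballI)
  assume F: "Cauchy_filter_on X (weak_uniformity X \<mu>) F"
  then show FX: "filter_on X F" unfolding Cauchy_filter_on_def by auto
  then have X: "X \<noteq> {}" unfolding filter_on_def by (auto simp: bot.extremum_unique)
  fix u assume "u \<in> U_fun X \<mu>"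
  then have "unif_continuous X (weak_uniformity X \<mu>) UNIV real_uniformity u"
    using weak_uniformity_eq(2)[OF \<mu> X] unfolding U_fun_def by auto
  then show "\<exists>l. (u \<longlongrightarrow> l) F"
    using Cauchy_filter_on_filtermap[OF F, of UNIV real_uniformity u] real_Cauchy_filter_iff[of u F] by simp
next
  assume *: "filter_on X F \<and> (\<forall>u\<in>U_fun X \<mu>. \<exists>l. (u \<longlongrightarrow> l) F)"
  then have FX: "F \<noteq> bot" "\<forall>\<^sub>F x in F. x \<in> X" unfolding filter_on_def le_principal by auto
  have X: "X \<noteq> {}" using * unfolding filter_on_def by (auto simp: bot.extremum_unique)
  obtain l where l: "\<And>u. u \<in> U_fun X \<mu> \<Longrightarrow> (u \<longlongrightarrow> l u) F" using * by metis
  show "Cauchy_filter_on X (weak_uniformity X \<mu>) F"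
    unfolding Cauchy_filter_on_def
  proof (intro conjI ballI)
    show "filter_on X F" using * by auto
    fix \<U> assume "\<U> \<in> weak_uniformity X \<mu>"
    then obtain \<Phi> \<epsilon> where U: "finite \<Phi>" "\<Phi> \<subseteq> U_fun X \<mu>" "\<epsilon> > 0" "refines (initial_cover X \<Phi> \<epsilon>) \<U>"
      unfolding weak_uniformity_eq(1)[OF \<mu> X] by (rule initial_uniformityE)
    have "\<forall>\<^sub>F x in F. \<forall>u\<in>\<Phi>. dist (u x) (l u) < \<epsilon>/2"
      using U tendstoD[OF l, of _ "\<epsilon>/2"] by (intro eventually_ball_finite) auto
    with FX(2) have ev: "\<forall>\<^sub>F x in F. x \<in> X \<and> (\<forall>u\<in>\<Phi>. dist (u x) (l u) < \<epsilon>/2)"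
      by (rule eventually_conj)
    then obtain x where x: "x \<in> X" "\<And>u. u \<in> \<Phi> \<Longrightarrow> dist (u x) (l u) < \<epsilon>/2"
      using eventually_happens'[OF FX(1) ev] by auto
    let ?N = "{y \<in> X. \<forall>u\<in>\<Phi>. \<bar>u y - u x\<bar> < \<epsilon>}"
    have "?N \<in> initial_cover X \<Phi> \<epsilon>" using x(1) unfolding initial_cover_def by (rule imageI)
    then obtain U where UU: "U \<in> \<U>" "?N \<subseteq> U" using U(4) unfolding refines_def by meson
    have "\<forall>\<^sub>F y in F. y \<in> ?N"
      using ev
    proof eventually_elim
      case (elim y)
      have "\<bar>u y - u x\<bar> < \<epsilon>" if "u \<in> \<Phi>" for u
      proof -
        have "dist (u y) (l u) < \<epsilon>/2" "dist (u x) (l u) < \<epsilon>/2" using elim x(2) that by auto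
        then show ?thesis unfolding dist_real_def by linarith
      qed
      then show ?case using elim by simp
    qed
    then have "\<forall>\<^sub>F y in F. y \<in> U" by (rule eventually_mono) (use UU(2) in auto)
    then show "\<exists>U\<in>\<U>. \<forall>\<^sub>F x in F. x \<in> U" using UU(1) by (rule bexI)
  qed
qed

section \<open>Cauchy-continuous functions are continuous\<close>

lemma continuous_map_real_nhdsin:
  fixes f :: "'a \<Rightarrow> real"
  shows "continuous_map T euclideanreal f \<longleftrightarrow> (\<forall>x\<in>topspace T. (f \<longlongrightarrow> f x) (nhdsin T x))"
  unfolding continuous_map_atin limitin_atin_self tendsto_def eventually_nhdsin
  by (auto simp: image_subset_iff)

lemma U_fun_continuous:
  assumes \<mu>: "covering_uniformity X \<mu>" and u: "u \<in> U_fun X \<mu>"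
  shows "continuous_map (uniform_topology X \<mu>) euclideanreal u"
  unfolding continuous_map_def topspace_uniform_topology[OF \<mu>] openin_uniform_topology[OF \<mu>]
proof (intro conjI allI impI ballI)
  fix W x assume W: "openin euclideanreal W" and x: "x \<in> {x \<in> X. u x \<in> W}"
  then obtain \<epsilon> where e: "\<epsilon> > 0" "ball (u x) \<epsilon> \<subseteq> W"
    using open_contains_ball[of W] by (auto simp del: mem_ball)
  obtain \<U> where U: "\<U> \<in> \<mu>" "\<forall>U\<in>\<U>. \<forall>y\<in>U. \<forall>z\<in>U. \<bar>u y - u z\<bar> < \<epsilon>"
    using u e(1) unfolding U_fun_iff[OF \<mu>] by auto
  have "St {x} \<U> \<subseteq> {x \<in> X. u x \<in> W}"
  proof
    fix y assume "y \<in> St {x} \<U>"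
    then obtain A where A: "A \<in> \<U>" "x \<in> A" "y \<in> A" unfolding St_def by auto
    then have "y \<in> X" using covering_uniformityD(2)[OF \<mu> U(1)] unfolding cover_of_def by auto
    moreover have "u y \<in> ball (u x) \<epsilon>" using U(2) A by (simp add: dist_real_def)
    ultimately show "y \<in> {x \<in> X. u x \<in> W}" using e(2) by auto
  qed
  then show "\<exists>\<U>\<in>\<mu>. St {x} \<U> \<subseteq> {x \<in> X. u x \<in> W}" using U(1) by (rule bexI)
qed auto

text \<open>The neighbourhood filter of a point is Cauchy for the weak uniformity, hence \<open>f\<close> has a limit along
  it, and this limit is the value of \<open>f\<close>.\<close>

lemma CC_fun_subset_C_fun:
  assumes \<mu>: "covering_uniformity X \<mu>"
  shows "CC_fun X (weak_uniformity X \<mu>) \<subseteq> C_fun (uniform_topology X \<mu>)"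
proof
  let ?T = "uniform_topology X \<mu>"
  note top = topspace_uniform_topology[OF \<mu>]
  fix f assume f: "f \<in> CC_fun X (weak_uniformity X \<mu>)"
  have "(f \<longlongrightarrow> f x) (nhdsin ?T x)" if x: "x \<in> X" for x
  proof -
    let ?N = "nhdsin ?T x"
    have self: "P x" if "eventually P ?N" for P
      using that x unfolding eventually_nhdsin top by auto
    have nb: "?N \<noteq> bot"
      using self[of "\<lambda>_. False"] by (auto simp: trivial_limit_def)
    have "eventually (\<lambda>y. y \<in> X) ?N"
      unfolding eventually_nhdsin using x openin_topspace[of ?T] top by auto
    then have "filter_on X ?N" using nb unfolding filter_on_def le_principal by auto
    moreover have "\<exists>l. (u \<longlongrightarrow> l) ?N" if "u \<in> U_fun X \<mu>" for u
      using U_fun_continuous[OF \<mu> that] x unfolding continuous_map_real_nhdsin top by auto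
    ultimately have "Cauchy_filter_on X (weak_uniformity X \<mu>) ?N"
      unfolding weak_Cauchy_filter_iff[OF \<mu>] by auto
    then have "Cauchy_filter_on UNIV real_uniformity (filtermap f ?N)"
      using f unfolding CC_fun_def by auto
    then obtain l where l: "(f \<longlongrightarrow> l) ?N" using real_Cauchy_filter_iff[of f ?N] by auto
    have "f x = l"
    proof (rule ccontr)
      assume "f x \<noteq> l"
      then have "dist (f x) l > 0" by simp
      from self[OF tendstoD[OF l this]] show False by simp
    qed
    then show ?thesis using l by simp
  qed
  then show "f \<in> C_fun ?T"
    unfolding C_fun_def mem_Collect_eq continuous_map_real_nhdsin top by auto
qed

section \<open>The closure of the image of the evaluation map\<close>

text \<open>The map of \<open>X\<close> into the power of the real line with index set \<open>L\<close>, whose \<open>u\<close>-coordinate is \<open>u\<close>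
  itself. Points of the power are extensional functions, hence the restriction.\<close>

definition evaluation :: "('a \<Rightarrow> real) set \<Rightarrow> 'a \<Rightarrow> ('a \<Rightarrow> real) \<Rightarrow> real"
  where "evaluation L x = restrict (\<lambda>u. u x) L"

text \<open>The closure of the image of \<open>X\<close> in the power, as a subspace. For \<open>L = U_fun X \<mu>\<close> it is the completion of
  \<open>X\<close> in the weak uniformity, of which only the topology and the convergence of Cauchy filters are
  needed.\<close>

definition evaluation_closure :: "'a set \<Rightarrow> ('a \<Rightarrow> real) set \<Rightarrow> (('a \<Rightarrow> real) \<Rightarrow> real) topology"
  where "evaluation_closure X L =
    (let P = product_topology (\<lambda>_. euclideanreal) L
     in subtopology P (P closure_of (evaluation L ` X)))"

text \<open>Openness onto the image is the place where uniformly continuous functions have to separate points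
  from closed sets.\<close>

lemma embedding_map_evaluation:
  assumes \<mu>: "covering_uniformity X \<mu>"
  shows "embedding_map (uniform_topology X \<mu>)
    (product_topology (\<lambda>_. euclideanreal) (U_fun X \<mu>)) (evaluation (U_fun X \<mu>))"
proof -
  let ?T = "uniform_topology X \<mu>" and ?L = "U_fun X \<mu>"
  let ?P = "product_topology (\<lambda>_. euclideanreal) ?L" and ?j = "evaluation ?L"
  note top = topspace_uniform_topology[OF \<mu>]
  have jP: "?j ` X \<subseteq> topspace ?P"
    by (auto simp: evaluation_def)
  have topj: "topspace (subtopology ?P (?j ` X)) = ?j ` X"
    by (rule topspace_subtopology_subset[OF jP])
  have "homeomorphic_map ?T (subtopology ?P (?j ` X)) ?j"
  proof (rule bijective_open_imp_homeomorphic_map)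
    have "continuous_map ?T ?P ?j"
      unfolding continuous_map_componentwise evaluation_def
      using U_fun_continuous[OF \<mu>] by (auto simp: continuous_map_def)
    then show "continuous_map ?T (subtopology ?P (?j ` X)) ?j"
      by (simp add: continuous_map_in_subtopology top)
    show "?j ` topspace ?T = topspace (subtopology ?P (?j ` X))"
      unfolding topj top ..
    show "inj_on ?j (topspace ?T)"
    proof (rule inj_onI, rule ccontr)
      fix x y assume "x \<in> topspace ?T" "y \<in> topspace ?T" and eq: "?j x = ?j y" and "x \<noteq> y"
      then obtain u where "u \<in> ?L" "u x \<noteq> u y"
        using U_fun_separates[OF \<mu>, of x y] unfolding top by auto
      then show False using fun_cong[OF eq, of u] by (simp add: evaluation_def)
    qed
    show "open_map ?T (subtopology ?P (?j ` X)) ?j"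
      unfolding open_map_def
    proof (intro allI impI)
      fix S assume S: "openin ?T S"
      have SX: "S \<subseteq> X" using openin_subset[OF S] unfolding top .
      show "openin (subtopology ?P (?j ` X)) (?j ` S)"
        unfolding openin_subopen[of _ "?j ` S"]
      proof
        fix w assume "w \<in> ?j ` S"
        then obtain x where x: "x \<in> S" "w = ?j x" by auto
        then obtain \<U> where U: "\<U> \<in> \<mu>" "St {x} \<U> \<subseteq> S"
          using S unfolding openin_uniform_topology[OF \<mu>] by auto
        obtain u where u: "u \<in> ?L" "u x = 0" "\<forall>y. y \<notin> St {x} \<U> \<longrightarrow> u y = 1"
          using uniform_Urysohn[OF \<mu> _ U(1), of x] x(1) SX by auto
        let ?W = "{v \<in> topspace ?P. v u \<in> {..<1}}"
        have "openin ?P ?W"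
          by (rule openin_continuous_map_preimage[OF continuous_map_product_projection[OF u(1)]]) simp
        then have "openin (subtopology ?P (?j ` X)) (?W \<inter> ?j ` X)"
          unfolding openin_subtopology by auto
        moreover have "w \<in> ?W \<inter> ?j ` X"
        proof -
          have "x \<in> X" using x SX by auto
          then have "w \<in> ?j ` X" using x by auto
          moreover have "w u = 0" using u x by (simp add: evaluation_def)
          ultimately show ?thesis using jP by auto
        qed
        moreover have "?W \<inter> ?j ` X \<subseteq> ?j ` S"
        proof
          fix v assume "v \<in> ?W \<inter> ?j ` X"
          then obtain y where y: "v = ?j y" "v u < 1" by auto
          then have "u y \<noteq> 1" using u(1) by (simp add: evaluation_def)
          then have "y \<in> S" using u(3) U(2) by auto
          then show "v \<in> ?j ` S" using y(1) by auto
        qed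
        ultimately show "\<exists>W'. openin (subtopology ?P (?j ` X)) W' \<and> w \<in> W' \<and> W' \<subseteq> ?j ` S"
          by (intro exI conjI)
      qed
    qed
  qed
  then show ?thesis unfolding embedding_map_def top .
qed

lemma realcompactification_evaluation_closure:
  assumes \<mu>: "covering_uniformity X \<mu>"
  defines "L \<equiv> U_fun X \<mu>"
  shows "realcompactification (uniform_topology X \<mu>) (evaluation_closure X L) (evaluation L)"
    and "\<forall>f\<in>L. extends_to (uniform_topology X \<mu>) (evaluation_closure X L) (evaluation L) f"
proof -
  let ?T = "uniform_topology X \<mu>" and ?H = "evaluation_closure X L" and ?j = "evaluation L"
  let ?P = "product_topology (\<lambda>_. euclideanreal) L"
  let ?K = "?P closure_of (?j ` X)"
  note top = topspace_uniform_topology[OF \<mu>]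
  have H: "?H = subtopology ?P ?K" unfolding evaluation_closure_def Let_def ..
  have jK: "?j ` X \<subseteq> ?K"
    by (rule closure_of_subset) (auto simp: evaluation_def)
  show "realcompactification ?T ?H ?j"
    unfolding realcompactification_def top
  proof (intro conjI)
    show "realcompact_space ?H"
      unfolding H by (rule realcompact_spaceI[OF closedin_closure_of homeomorphic_space_refl])
    have "subtopology ?H (?j ` X) = subtopology ?P (?j ` X)"
      unfolding H subtopology_subtopology using jK by (simp add: Int_absorb1)
    then show "embedding_map ?T ?H ?j"
      using embedding_map_evaluation[OF \<mu>] unfolding embedding_map_def top L_def by simp
    show "?H closure_of (?j ` X) = topspace ?H"
      unfolding H closure_of_subtopology using jK
      by (simp add: Int_absorb1 closure_of_subset_topspace topspace_subtopology_subset del: topspace_product_topology)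
  qed
  show "\<forall>f\<in>L. extends_to ?T ?H ?j f"
    unfolding extends_to_def H
    by (intro ballI exI[of _ "\<lambda>v. v f" for f] conjI continuous_map_from_subtopology
        continuous_map_product_projection) (auto simp: evaluation_def)
qed

lemma limitin_evaluation_closure:
  fixes L :: "('a \<Rightarrow> real) set"
  assumes F: "filter_on X F" and lim: "\<And>u. u \<in> L \<Longrightarrow> \<exists>l. (u \<longlongrightarrow> l) F"
  shows "\<exists>w. limitin (evaluation_closure X L) (evaluation L) w F"
proof -
  let ?P = "product_topology (\<lambda>_. euclideanreal) L" and ?j = "evaluation L"
  have FX: "F \<noteq> bot" "\<forall>\<^sub>F x in F. x \<in> X"
    using F unfolding filter_on_def le_principal by auto
  obtain l where l: "\<And>u. u \<in> L \<Longrightarrow> (u \<longlongrightarrow> l u) F" using lim by metis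
  have "limitin ?P ?j (restrict l L) F"
    unfolding limitin_componentwise
  proof (intro conjI ballI)
    show "limitin euclideanreal (\<lambda>x. ?j x u) (restrict l L u) F" if "u \<in> L" for u
      using l[OF that] that by (simp add: evaluation_def)
  qed (auto simp: evaluation_def)
  moreover have ev: "\<forall>\<^sub>F x in F. ?j x \<in> ?P closure_of (?j ` X)"
    using FX(2)
  proof eventually_elim
    case (elim x)
    have "?j ` X \<subseteq> ?P closure_of (?j ` X)"
      by (rule closure_of_subset) (auto simp: evaluation_def)
    then show ?case using elim by auto
  qed
  ultimately have "limitin (evaluation_closure X L) ?j (restrict l L) F"
    unfolding evaluation_closure_def Let_def limitin_subtopology
    using limitin_closedin[OF _ closedin_closure_of ev FX(1)] by auto
  then show ?thesis by (intro exI)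
qed

section \<open>Continuous functions are Cauchy-continuous\<close>

text \<open>Minimality of \<open>Z\<close> yields a map from the evaluation closure to \<open>Z\<close> that is the identity on \<open>X\<close>; composed
  with \<open>Z \<rightarrow> Y\<close> and the extension of \<open>f\<close> to \<open>Y\<close> it extends \<open>f\<close> to the evaluation closure, where
  weakly Cauchy filters converge.\<close>

lemma C_fun_subset_CC_fun:
  assumes \<mu>: "covering_uniformity X \<mu>"
    and Y: "\<forall>f \<in> C_fun (uniform_topology X \<mu>). extends_to (uniform_topology X \<mu>) Y e f"
    and Z: "Samuel_realcompactification X \<mu> Z k"
    and eq: "equivalent_realcompactifications (uniform_topology X \<mu>) Y e Z k"
    and ecarrier: "e ` X \<subseteq> topspace Y"
  shows "C_fun (uniform_topology X \<mu>) \<subseteq> CC_fun X (weak_uniformity X \<mu>)"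
proof
  let ?T = "uniform_topology X \<mu>" and ?L = "U_fun X \<mu>"
  note top = topspace_uniform_topology[OF \<mu>]
  let ?H = "evaluation_closure X ?L" and ?j = "evaluation ?L"
  fix f assume "f \<in> C_fun ?T"
  then obtain g where g: "continuous_map Y euclideanreal g" "\<And>x. x \<in> X \<Longrightarrow> g (e x) = f x"
    using Y unfolding extends_to_def top by auto
  obtain h where h: "homeomorphic_map Y Z h" "\<And>x. x \<in> X \<Longrightarrow> h (e x) = k x"
    using eq unfolding equivalent_realcompactifications_def top by auto
  obtain h' where h': "homeomorphic_maps Y Z h h'"
    using h(1) unfolding homeomorphic_map_maps by auto
  have "realcompactification_le ?T Z k ?H ?j"
    using Z smallest_realcompactification_le[OF _ realcompactification_evaluation_closure[OF \<mu>]]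
    unfolding Samuel_realcompactification_def by auto
  then obtain r where r: "continuous_map ?H Z r" "\<And>x. x \<in> X \<Longrightarrow> r (?j x) = k x"
    unfolding realcompactification_le_def top by auto
  define G where "G = g \<circ> h' \<circ> r"
  have "continuous_map Z Y h'" using h' unfolding homeomorphic_maps_def by auto
  then have G: "continuous_map ?H euclideanreal G"
    unfolding G_def using g(1) r(1) by (intro continuous_map_compose)
  have Gj: "G (?j x) = f x" if "x \<in> X" for x
  proof -
    have "h' (h (e x)) = e x" using h' ecarrier that unfolding homeomorphic_maps_def by auto
    then show ?thesis using that by (simp add: G_def r(2) g(2) flip: h(2))
  qed
  show "f \<in> CC_fun X (weak_uniformity X \<mu>)"
    unfolding CC_fun_def mem_Collect_eq
  proof (intro allI impI)
    fix F assume "Cauchy_filter_on X (weak_uniformity X \<mu>) F"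
    then have F: "filter_on X F" "\<And>u. u \<in> ?L \<Longrightarrow> \<exists>l. (u \<longlongrightarrow> l) F"
      unfolding weak_Cauchy_filter_iff[OF \<mu>] by auto
    obtain w where w: "limitin ?H ?j w F" using limitin_evaluation_closure[OF F] by auto
    have "((G \<circ> ?j) \<longlongrightarrow> G w) F" using continuous_map_limit[OF G w] by simp
    moreover have "\<forall>\<^sub>F x in F. (G \<circ> ?j) x = f x"
      using F(1) Gj unfolding filter_on_def le_principal by (auto elim: eventually_mono)
    ultimately have "(f \<longlongrightarrow> G w) F" by (rule Lim_transform_eventually)
    then show "Cauchy_filter_on UNIV real_uniformity (filtermap f F)"
      using F(1) unfolding real_Cauchy_filter_iff filter_on_def by auto
  qed
qed

lemma C_fun_eq_CC_fun:
  assumes \<mu>: "covering_uniformity X \<mu>"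
    and Y: "Hewitt_realcompactification (uniform_topology X \<mu>) Y e"
    and Z: "Samuel_realcompactification X \<mu> Z k"
    and eq: "equivalent_realcompactifications (uniform_topology X \<mu>) Y e Z k"
  shows "C_fun (uniform_topology X \<mu>) = CC_fun X (weak_uniformity X \<mu>)"
proof (rule antisym[OF C_fun_subset_CC_fun[OF \<mu> _ Z eq] CC_fun_subset_C_fun[OF \<mu>]])
  show "\<forall>f \<in> C_fun (uniform_topology X \<mu>). extends_to (uniform_topology X \<mu>) Y e f"
    using Y unfolding Hewitt_realcompactification_def smallest_realcompactification_def by auto
  have "embedding_map (uniform_topology X \<mu>) Y e"
    using Y unfolding Hewitt_realcompactification_def smallest_realcompactification_def
      realcompactification_def by auto
  then show "e ` X \<subseteq> topspace Y"
    using homeomorphic_imp_surjective_map[of "uniform_topology X \<mu>" "subtopology Y (e ` X)" e]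
    unfolding embedding_map_def topspace_uniform_topology[OF \<mu>] topspace_subtopology by auto
qed

section \<open>Ultrafilters\<close>

text \<open>Proper filters that decide every predicate; these are the proper filters minimal with respect to \<open>\<le>\<close>.\<close>

definition ultrafilter :: "'a filter \<Rightarrow> bool"
  where "ultrafilter G \<longleftrightarrow> G \<noteq> bot \<and> (\<forall>P. eventually P G \<or> eventually (\<lambda>x. \<not> P x) G)"

lemma exists_ultrafilter_le:
  assumes "F \<noteq> bot"
  shows "\<exists>G. ultrafilter G \<and> G \<le> F"
proof -
  define A where "A = {G. G \<noteq> bot \<and> G \<le> F}"
  have "\<exists>m\<in>A. \<forall>a\<in>A. a \<le> m \<longrightarrow> a = m"
  proof (rule predicate_Zorn)
    show "partial_order_on A (relation_of (\<lambda>x y. y \<le> x) A)"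
      by (rule partial_order_on_relation_ofI) auto
    fix C assume "C \<in> Chains (relation_of (\<lambda>x y. y \<le> x) A)"
    then have C: "\<And>x y. x \<in> C \<Longrightarrow> y \<in> C \<Longrightarrow> x \<in> A \<and> (x \<le> y \<or> y \<le> x)"
      unfolding Chains_def relation_of_def by fastforce
    show "\<exists>u\<in>A. \<forall>a\<in>C. u \<le> a"
    proof (cases "C = {}")
      case True
      then show ?thesis using assms by (auto simp: A_def)
    next
      case False
      have "eventually (\<lambda>_. False) (Inf C) \<longleftrightarrow> (\<exists>b\<in>C. eventually (\<lambda>_. False) b)"
      proof (rule eventually_Inf_base[OF False])
        fix G H assume GH: "G \<in> C" "H \<in> C"
        then have "G \<le> H \<or> H \<le> G" using C by auto
        then show "\<exists>x\<in>C. x \<le> inf G H" using GH by (auto intro: bexI[of _ G] bexI[of _ H])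
      qed
      then have "Inf C \<noteq> bot" using C unfolding A_def trivial_limit_def by auto
      moreover obtain G where "G \<in> C" using False by auto
      then have "Inf C \<le> F" using C[of G G] unfolding A_def by (auto intro: Inf_lower2)
      ultimately show ?thesis unfolding A_def by (intro bexI[of _ "Inf C"]) (auto intro: Inf_lower)
    qed
  qed
  then obtain G where G: "G \<noteq> bot" "G \<le> F" and min: "\<And>H. H \<noteq> bot \<Longrightarrow> H \<le> F \<Longrightarrow> H \<le> G \<Longrightarrow> H = G"
    unfolding A_def by auto
  have "eventually P G \<or> eventually (\<lambda>x. \<not> P x) G" for P
  proof (rule disjCI)
    assume n: "\<not> eventually (\<lambda>x. \<not> P x) G"
    let ?H = "inf G (principal (Collect P))"
    have "?H \<noteq> bot" using n unfolding trivial_limit_def eventually_inf_principal by simp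
    moreover have "?H \<le> G" by simp
    ultimately have "?H = G" using min G(2) by (meson order_trans)
    moreover have "eventually P ?H" unfolding eventually_inf_principal by simp
    ultimately show "eventually P G" by simp
  qed
  then show ?thesis using G unfolding ultrafilter_def by auto
qed

lemma ultrafilter_bounded_tendsto:
  fixes u :: "'a \<Rightarrow> real"
  assumes G: "ultrafilter G" and bd: "\<forall>\<^sub>F x in G. \<bar>u x - c\<bar> \<le> r"
  shows "\<exists>l. (u \<longlongrightarrow> l) G"
proof -
  have "\<forall>\<^sub>F y in filtermap u G. y \<in> cball c r"
    using bd unfolding eventually_filtermap by eventually_elim (simp add: dist_real_def abs_minus_commute)
  moreover have "filtermap u G \<noteq> bot" using G unfolding ultrafilter_def filtermap_bot_iff by simp
  ultimately obtain l where l: "inf (nhds l) (filtermap u G) \<noteq> bot"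
    using compact_cball[of c r] unfolding compact_filter by auto
  have "eventually P (filtermap u G)" if P: "eventually P (nhds l)" for P
  proof (rule ccontr)
    assume "\<not> eventually P (filtermap u G)"
    then have "eventually (\<lambda>y. \<not> P y) (filtermap u G)"
      using G unfolding ultrafilter_def eventually_filtermap by auto
    then have "eventually (\<lambda>_. False) (inf (nhds l) (filtermap u G))"
      unfolding eventually_inf using P by (intro exI conjI) auto
    then show False using l unfolding trivial_limit_def by simp
  qed
  then have "filtermap u G \<le> nhds l" unfolding le_filter_def by auto
  then show ?thesis unfolding filterlim_def by auto
qed

section \<open>Bourbaki-completeness\<close>

lemma St_iter_mono:
  assumes "refines \<V> \<U>" "A \<subseteq> B"
  shows "St_iter m A \<V> \<subseteq> St_iter m B \<U>"
proof (induction m)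
  case (Suc m)
  show ?case
  proof
    fix y assume "y \<in> St_iter (Suc m) A \<V>"
    then obtain V where V: "V \<in> \<V>" "V \<inter> St_iter m A \<V> \<noteq> {}" "y \<in> V" by (auto simp: St_def)
    then obtain U where "U \<in> \<U>" "V \<subseteq> U" using assms(1) unfolding refines_def by auto
    moreover from this have "U \<inter> St_iter m B \<U> \<noteq> {}" using V(2) Suc.IH by auto
    ultimately show "y \<in> St_iter (Suc m) B \<U>" using V(3) by (auto simp: St_def)
  qed
qed (use assms in simp)

context Metric_space
begin

text \<open>If \<open>u\<close> oscillates by less than 1 on each member of a cover, then on the \<open>m\<close>-fold star of
  a member it differs by at most \<open>m + 1\<close> from its value at any point of that member.\<close>

lemma U_fun_bounded_on_Bourbaki_Cauchy_filter:
  assumes F: "Bourbaki_Cauchy_filter M d F" and u: "u \<in> U_fun M (metric_uniformity M d)"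
  shows "\<exists>c r. \<forall>\<^sub>F x in F. \<bar>u x - c\<bar> \<le> r"
proof -
  obtain \<U> where U: "\<U> \<in> metric_uniformity M d" "\<And>U y z. U \<in> \<U> \<Longrightarrow> y \<in> U \<Longrightarrow> z \<in> U \<Longrightarrow> \<bar>u y - u z\<bar> < 1"
    using u zero_less_one unfolding U_fun_iff[OF covering_uniformity_metric] by meson
  then obtain m A where A: "A \<in> \<U>" "\<forall>\<^sub>F x in F. x \<in> St_iter m A \<U>"
    using F unfolding Bourbaki_Cauchy_filter_def by auto
  \<comment> \<open>If \<open>A\<close> is empty, so are its iterated stars, and the arbitrary value of \<open>c\<close> is harmless.\<close>
  define c where "c = u (SOME a. a \<in> A)"
  have "\<bar>u y - c\<bar> \<le> real k + 1" if "y \<in> St_iter k A \<U>" for y k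
    using that
  proof (induction k arbitrary: y)
    case 0
    then have "\<bar>u y - c\<bar> < 1" unfolding c_def by (intro U(2)[OF A(1)]) (auto intro: someI)
    then show ?case by simp
  next
    case (Suc k)
    then obtain W z where W: "W \<in> \<U>" "y \<in> W" "z \<in> W" "z \<in> St_iter k A \<U>" by (auto simp: St_def)
    have "\<bar>u y - u z\<bar> < 1" using U(2) W by auto
    moreover have "\<bar>u z - c\<bar> \<le> real k + 1" using Suc.IH W by auto
    ultimately show ?case by simp
  qed
  then have "\<forall>\<^sub>F x in F. \<bar>u x - c\<bar> \<le> real m + 1" using A(2) by (auto elim: eventually_mono)
  then show ?thesis by auto
qed

text \<open>Uniformly continuous functions are bounded along \<open>F\<close>, so by compactness of bounded intervals they
  converge along every finer ultrafilter.\<close>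

lemma ultrafilter_weak_Cauchy:
  assumes F: "Bourbaki_Cauchy_filter M d F" and G: "ultrafilter G" "G \<le> F"
  shows "Cauchy_filter_on M (weak_uniformity M (metric_uniformity M d)) G"
  unfolding weak_Cauchy_filter_iff[OF covering_uniformity_metric]
proof (intro conjI ballI)
  show "filter_on M G"
    using F G unfolding Bourbaki_Cauchy_filter_def filter_on_def ultrafilter_def by auto
  fix u assume u: "u \<in> U_fun M (metric_uniformity M d)"
  obtain c r where "\<forall>\<^sub>F x in F. \<bar>u x - c\<bar> \<le> r"
    using U_fun_bounded_on_Bourbaki_Cauchy_filter[OF F u] by auto
  then have "\<forall>\<^sub>F x in G. \<bar>u x - c\<bar> \<le> r" using G(2) by (rule filter_leD[rotated])
  then show "\<exists>l. (u \<longlongrightarrow> l) G" by (rule ultrafilter_bounded_tendsto[OF G(1)])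
qed

lemma Lipschitz_U_fun:
  assumes "\<And>x y. x \<in> M \<Longrightarrow> y \<in> M \<Longrightarrow> g x \<le> g y + d x y"
  shows "g \<in> U_fun M (metric_uniformity M d)"
  unfolding U_fun_iff[OF covering_uniformity_metric]
proof (intro allI impI)
  fix \<epsilon> :: real assume e: "\<epsilon> > 0"
  have "\<bar>g y - g z\<bar> < \<epsilon>" if U: "U \<in> (\<lambda>x. mball x (\<epsilon>/2)) ` M" "y \<in> U" "z \<in> U" for U y z
  proof -
    obtain x where x: "x \<in> M" "y \<in> M" "z \<in> M" "d x y < \<epsilon>/2" "d x z < \<epsilon>/2" using U by auto
    then have "d y z < \<epsilon>" using triangle[of y x z] commute[of x y] by simp
    then show ?thesis using assms[of y z] assms[of z y] commute[of y z] x by simp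
  qed
  then show "\<exists>\<U>\<in>metric_uniformity M d. \<forall>U\<in>\<U>. \<forall>y\<in>U. \<forall>z\<in>U. \<bar>g y - g z\<bar> < \<epsilon>"
    using mballs_in_metric_uniformity[of "\<epsilon>/2"] e by (intro bexI ballI) auto
qed

text \<open>If the sequence has no cluster point, the Lipschitz function \<open>g\<close> below is positive everywhere and
  tends to 0 along the sequence. Its reciprocal is continuous but unbounded along every
  ultrafilter finer than the sequence; such an ultrafilter is Cauchy for the weak uniformity,
  so the reciprocal is not Cauchy-continuous.\<close>

lemma Bourbaki_Cauchy_sequence_clusters:
  assumes CC: "C_fun mtopology \<subseteq> CC_fun M (weak_uniformity M (metric_uniformity M d))"
    and \<sigma>: "\<And>n. \<sigma> n \<in> M"
    and BC: "Bourbaki_Cauchy_filter M d (filtermap \<sigma> sequentially)"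
  shows "\<exists>p\<in>M. \<forall>e>0. \<forall>N. \<exists>n\<ge>N. d p (\<sigma> n) < e"
proof (rule ccontr)
  assume neg: "\<not> (\<exists>p\<in>M. \<forall>e>0. \<forall>N. \<exists>n\<ge>N. d p (\<sigma> n) < e)"
  define g where "g p = (INF n. d p (\<sigma> n) + 1 / (real n + 1))" for p
  have bdd: "bdd_below (range (\<lambda>n. d p (\<sigma> n) + 1 / (real n + 1)))" for p
    by (rule bdd_belowI[of _ 0]) auto
  have g_le: "g p \<le> d p (\<sigma> n) + 1 / (real n + 1)" for p n
    unfolding g_def by (rule cINF_lower[OF bdd]) simp
  have pos: "g p > 0" if "p \<in> M" for p
  proof -
    have "\<exists>e>0. \<exists>N. \<forall>n\<ge>N. e \<le> d p (\<sigma> n)" using neg that by (auto simp: not_less)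
    then obtain e N where e: "e > 0" "\<And>n. n \<ge> N \<Longrightarrow> d p (\<sigma> n) \<ge> e" by auto
    have "min e (1 / (real N + 1)) \<le> g p"
      unfolding g_def
    proof (rule cINF_greatest)
      fix n
      show "min e (1 / (real N + 1)) \<le> d p (\<sigma> n) + 1 / (real n + 1)"
      proof (cases "n \<ge> N")
        case True
        then show ?thesis using e(2)[OF True] by (simp add: min.coboundedI1 add_increasing2)
      next
        case False
        then have "1 / (real N + 1) \<le> 1 / (real n + 1)" by (intro divide_left_mono) auto
        then show ?thesis by (simp add: min.coboundedI2 add_increasing)
      qed
    qed simp
    moreover have "min e (1 / (real N + 1)) > 0" using e(1) by simp
    ultimately show ?thesis by linarith
  qed
  have "g x \<le> g y + d x y" if xy: "x \<in> M" "y \<in> M" for x y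
  proof -
    have "g x - d x y \<le> g y"
      unfolding g_def[of y]
    proof (rule cINF_greatest)
      fix n
      show "g x - d x y \<le> d y (\<sigma> n) + 1 / (real n + 1)"
        using g_le[of x n] triangle[OF xy \<sigma>[of n]] by simp
    qed simp
    then show ?thesis by simp
  qed
  then have "continuous_map mtopology euclideanreal g"
    using U_fun_continuous[OF covering_uniformity_metric Lipschitz_U_fun] unfolding uniform_topology_metric by auto
  then have "continuous_map mtopology euclideanreal (\<lambda>x. inverse (g x))"
    using pos by (intro continuous_map_real_inverse) fastforce+
  then have f: "(\<lambda>x. inverse (g x)) \<in> CC_fun M (weak_uniformity M (metric_uniformity M d))"
    using CC unfolding C_fun_def by auto
  have big: "inverse (g (\<sigma> n)) \<ge> real n + 1" for n
  proof -
    have "g (\<sigma> n) \<le> inverse (real n + 1)" using g_le[of "\<sigma> n" n] \<sigma>[of n] by (simp add: inverse_eq_divide)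
    then have "inverse (inverse (real n + 1)) \<le> inverse (g (\<sigma> n))" using pos[OF \<sigma>] by (rule le_imp_inverse_le)
    then show ?thesis by simp
  qed
  obtain G where G: "ultrafilter G" "G \<le> filtermap \<sigma> sequentially"
    using exists_ultrafilter_le[of "filtermap \<sigma> sequentially"] by (auto simp: filtermap_bot_iff)
  have "Cauchy_filter_on UNIV real_uniformity (filtermap (\<lambda>x. inverse (g x)) G)"
    using f ultrafilter_weak_Cauchy[OF BC G] unfolding CC_fun_def by auto
  then obtain l where "((\<lambda>x. inverse (g x)) \<longlongrightarrow> l) G" unfolding real_Cauchy_filter_iff by auto
  then have "\<forall>\<^sub>F x in G. dist (inverse (g x)) l < 1" by (rule tendstoD) simp
  moreover have "\<forall>\<^sub>F x in G. inverse (g x) \<ge> l + 1"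
  proof (rule filter_leD[OF G(2)])
    have "\<forall>\<^sub>F n in sequentially. real n \<ge> l" using filterlim_real_sequentially unfolding filterlim_at_top by auto
    then show "\<forall>\<^sub>F x in filtermap \<sigma> sequentially. inverse (g x) \<ge> l + 1"
      unfolding eventually_filtermap
    proof eventually_elim
      case (elim n)
      then show ?case using big[of n] by linarith
    qed
  qed
  ultimately have "\<forall>\<^sub>F x in G. False"
    by eventually_elim (simp add: dist_real_def)
  then show False using G(1) unfolding ultrafilter_def trivial_limit_def by auto
qed

text \<open>Reduction of filters to sequences. Let \<open>G\<close> be an ultrafilter finer than \<open>F\<close>. A sequence that follows
  the iterated stars \<open>Q n\<close> belonging to the radii \<open>1/(n+1)\<close> is Bourbaki-Cauchy and hence clusters.
  Therefore \<open>G\<close> contains balls of every radius, since otherwise such a sequence could be chosen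
  \<open>\<epsilon>\<close>-separated; and the cluster point of such a sequence chosen inside these balls is a limit of
  \<open>G\<close>.\<close>

lemma Bourbaki_complete_if_C_fun_subset_CC_fun:
  assumes CC: "C_fun mtopology \<subseteq> CC_fun M (weak_uniformity M (metric_uniformity M d))"
  shows "Bourbaki_complete M d"
  unfolding Bourbaki_complete_def
proof (intro allI impI)
  fix F assume F: "Bourbaki_Cauchy_filter M d F"
  then have Fnb: "F \<noteq> bot" and FM: "\<forall>\<^sub>F x in F. x \<in> M"
    unfolding Bourbaki_Cauchy_filter_def filter_on_def le_principal by auto
  obtain G where G: "ultrafilter G" "G \<le> F" using exists_ultrafilter_le[OF Fnb] by auto
  have Gnb: "G \<noteq> bot" and GM: "\<forall>\<^sub>F x in G. x \<in> M"
    using G filter_leD[OF G(2) FM] unfolding ultrafilter_def by auto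
  let ?B = "\<lambda>n. (\<lambda>x. mball x (1 / (real n + 1))) ` M"
  have "\<exists>m A. A \<in> ?B n \<and> (\<forall>\<^sub>F x in F. x \<in> St_iter m A (?B n))" for n
    using F mballs_in_metric_uniformity[of "1 / (real n + 1)"] unfolding Bourbaki_Cauchy_filter_def
    by fastforce
  then obtain m A where A: "\<And>n. A n \<in> ?B n" "\<And>n. \<forall>\<^sub>F x in F. x \<in> St_iter (m n) (A n) (?B n)"
    by metis
  define Q where "Q n = St_iter (m n) (A n) (?B n)" for n
  have Q: "\<forall>\<^sub>F x in G. x \<in> Q n" for n
    using filter_leD[OF G(2) A(2)] unfolding Q_def .
  have cluster: "\<exists>p\<in>M. \<forall>e>0. \<forall>N. \<exists>n\<ge>N. d p (\<sigma> n) < e"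
    if \<sigma>: "\<And>n. \<sigma> n \<in> M" and \<sigma>Q: "\<And>i n. i \<le> n \<Longrightarrow> \<sigma> n \<in> Q i" for \<sigma>
  proof (rule Bourbaki_Cauchy_sequence_clusters[OF CC \<sigma>])
    show "Bourbaki_Cauchy_filter M d (filtermap \<sigma> sequentially)"
      unfolding Bourbaki_Cauchy_filter_def
    proof (intro conjI ballI)
      show "filter_on M (filtermap \<sigma> sequentially)"
        using \<sigma> by (simp add: filter_on_def le_principal filtermap_bot_iff eventually_filtermap)
      fix \<U> assume "\<U> \<in> metric_uniformity M d"
      then obtain \<epsilon> where e: "\<epsilon> > 0" "refines ((\<lambda>x. mball x \<epsilon>) ` M) \<U>"
        unfolding metric_uniformity_def mem_Collect_eq by (elim conjE exE) (rule that)
      obtain N where N: "1 / (real N + 1) < \<epsilon>"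
        using reals_Archimedean[OF e(1)] by (auto simp: inverse_eq_divide add.commute)
      have "refines (?B N) ((\<lambda>x. mball x \<epsilon>) ` M)"
        using N unfolding refines_def by fastforce
      then have ref: "refines (?B N) \<U>" using e(2) by (rule refines_trans)
      then obtain U where U: "U \<in> \<U>" "A N \<subseteq> U" using A(1)[of N] unfolding refines_def by auto
      have "\<sigma> n \<in> St_iter (m N) U \<U>" if "N \<le> n" for n
        using \<sigma>Q[OF that] St_iter_mono[OF ref U(2)] unfolding Q_def by auto
      then have "\<forall>\<^sub>F x in filtermap \<sigma> sequentially. x \<in> St_iter (m N) U \<U>"
        unfolding eventually_filtermap eventually_sequentially by auto
      then show "\<exists>m. \<exists>U\<in>\<U>. \<forall>\<^sub>F x in filtermap \<sigma> sequentially. x \<in> St_iter m U \<U>"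
        using U(1) by auto
    qed
  qed
  have small: "\<exists>z\<in>M. \<forall>\<^sub>F x in G. x \<in> mball z \<epsilon>" if e: "\<epsilon> > 0" for \<epsilon>
  proof (rule ccontr)
    assume "\<not> (\<exists>z\<in>M. \<forall>\<^sub>F x in G. x \<in> mball z \<epsilon>)"
    then have far: "\<forall>\<^sub>F x in G. x \<notin> mball z \<epsilon>" if "z \<in> M" for z
      using G(1) that unfolding ultrafilter_def by auto
    \<comment> \<open>\<open>R \<sigma> n x\<close>: the point \<open>x\<close> is an admissible \<open>n\<close>-th term after the terms \<open>\<sigma> i\<close> with \<open>i < n\<close>.\<close>
    define R where "R \<sigma> n x \<longleftrightarrow> x \<in> M \<and> (\<forall>i\<le>n. x \<in> Q i) \<and> (\<forall>i<n. x \<notin> mball (\<sigma> i) \<epsilon>)"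
      for \<sigma> :: "nat \<Rightarrow> 'a" and n x
    have "\<exists>\<sigma>. \<forall>n. R \<sigma> n (\<sigma> n)"
    proof (rule dependent_wellorder_choice)
      show "R f n x = R g n x" if "\<And>k. k < n \<Longrightarrow> f k = g k" for f g n x
        using that unfolding R_def by auto
      fix n f assume f: "\<And>k. k < n \<Longrightarrow> R f k (f k)"
      have "\<forall>\<^sub>F x in G. \<forall>i\<in>{..n}. x \<in> Q i"
        using Q by (intro eventually_ball_finite) auto
      moreover have "\<forall>\<^sub>F x in G. \<forall>i\<in>{..<n}. x \<notin> mball (f i) \<epsilon>"
        using far f unfolding R_def by (intro eventually_ball_finite) auto
      ultimately have "\<forall>\<^sub>F x in G. R f n x"
        using GM by eventually_elim (auto simp: R_def)
      then show "\<exists>x. R f n x" using Gnb by (rule eventually_happens'[rotated])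
    qed
    then obtain \<sigma> where \<sigma>: "\<And>n. R \<sigma> n (\<sigma> n)" by auto
    then have "\<exists>p\<in>M. \<forall>e>0. \<forall>N. \<exists>n\<ge>N. d p (\<sigma> n) < e" unfolding R_def by (intro cluster) auto
    then obtain p where p: "p \<in> M" "\<And>e N. e > 0 \<Longrightarrow> \<exists>n\<ge>N. d p (\<sigma> n) < e" by auto
    \<comment> \<open>Two terms close to a cluster point contradict the separation.\<close>
    obtain i where i: "d p (\<sigma> i) < \<epsilon>/2" using p(2)[of "\<epsilon>/2" 0] e by auto
    obtain n where n: "n \<ge> Suc i" "d p (\<sigma> n) < \<epsilon>/2" using p(2)[of "\<epsilon>/2" "Suc i"] e by auto
    have M: "\<sigma> i \<in> M" "\<sigma> n \<in> M" using \<sigma> unfolding R_def by auto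
    have "d (\<sigma> i) (\<sigma> n) < \<epsilon>" using triangle[of "\<sigma> i" p "\<sigma> n"] M p(1) i n(2) commute[of p "\<sigma> i"] by simp
    moreover have "\<sigma> n \<notin> mball (\<sigma> i) \<epsilon>" using \<sigma>[of n] n(1) unfolding R_def by auto
    ultimately show False using M by simp
  qed
  have "\<exists>z\<in>M. \<forall>\<^sub>F x in G. x \<in> mball z (1 / (real n + 1))" for n by (rule small) simp
  then obtain z where z: "\<And>n. z n \<in> M" "\<And>n. \<forall>\<^sub>F x in G. x \<in> mball (z n) (1 / (real n + 1))"
    by metis
  have "\<exists>x. x \<in> M \<and> (\<forall>i\<in>{..n}. x \<in> Q i \<and> x \<in> mball (z i) (1 / (real i + 1)))" for n
  proof -
    have "\<forall>\<^sub>F x in G. \<forall>i\<in>{..n}. x \<in> Q i \<and> x \<in> mball (z i) (1 / (real i + 1))"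
      using Q z(2) by (intro eventually_ball_finite ballI eventually_conj) auto
    with GM have "\<forall>\<^sub>F x in G. x \<in> M \<and> (\<forall>i\<in>{..n}. x \<in> Q i \<and> x \<in> mball (z i) (1 / (real i + 1)))"
      by (rule eventually_conj)
    then show ?thesis using Gnb by (rule eventually_happens'[rotated])
  qed
  then obtain \<sigma> where \<sigma>: "\<And>n. \<sigma> n \<in> M" "\<And>n i. i \<le> n \<Longrightarrow> \<sigma> n \<in> Q i"
    "\<And>n i. i \<le> n \<Longrightarrow> \<sigma> n \<in> mball (z i) (1 / (real i + 1))"
    by (metis atMost_iff)
  obtain p where p: "p \<in> M" "\<And>e N. e > 0 \<Longrightarrow> \<exists>n\<ge>N. d p (\<sigma> n) < e"
    using cluster[of \<sigma>] \<sigma>(1,2) by auto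
  have "cluster_point mtopology F p"
    unfolding cluster_point_def
  proof (intro conjI allI impI)
    show "p \<in> topspace mtopology" using p(1) by simp
    fix W assume "openin mtopology W \<and> p \<in> W"
    then obtain r where r: "r > 0" "mball p r \<subseteq> W" unfolding openin_mtopology by auto
    obtain i where i: "1 / (real i + 1) < r/3"
      using reals_Archimedean[of "r/3"] r(1) by (auto simp: inverse_eq_divide add.commute)
    obtain n where n: "n \<ge> i" "d p (\<sigma> n) < r/3" using p(2)[of "r/3" i] r(1) by auto
    have zn: "d (z i) (\<sigma> n) < 1 / (real i + 1)" using \<sigma>(3)[OF n(1)] by simp
    have "\<forall>\<^sub>F x in G. x \<in> W"
      using z(2)[of i]
    proof eventually_elim
      case (elim x)
      then have x: "x \<in> M" "d (z i) x < 1 / (real i + 1)" by auto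
      have "d p x < r"
        using triangle[OF p(1) \<sigma>(1)[of n] x(1)] triangle[OF \<sigma>(1)[of n] z(1)[of i] x(1)]
          commute[of "z i" "\<sigma> n"] x(2) zn i n(2) by simp
      then show ?case using x(1) p(1) r(2) by auto
    qed
    moreover have "\<not> (\<forall>\<^sub>F x in G. x \<notin> W)" if "\<forall>\<^sub>F x in G. x \<in> W"
    proof
      assume "\<forall>\<^sub>F x in G. x \<notin> W"
      with that have "\<forall>\<^sub>F x in G. False" by eventually_elim simp
      then show False using Gnb unfolding trivial_limit_def by simp
    qed
    ultimately show "\<exists>\<^sub>F y in F. y \<in> W"
      unfolding frequently_def using filter_leD[OF G(2)] by auto
  qed
  then show "\<exists>x. cluster_point mtopology F x" by auto
qed

end

section \<open>Equivalence of the Hewitt and the Samuel realcompactifications\<close>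

theorem theorem3p2p2:
  shows "(\<forall>(X :: 'a set) \<mu> (Y :: 'b topology) e (Z :: 'c topology) k.
      covering_uniformity X \<mu> \<and>
      Hewitt_realcompactification (uniform_topology X \<mu>) Y e \<and>
      Samuel_realcompactification X \<mu> Z k \<and>
      equivalent_realcompactifications (uniform_topology X \<mu>) Y e Z k
      \<longrightarrow> C_fun (uniform_topology X \<mu>) = CC_fun X (weak_uniformity X \<mu>))
    \<and> (\<forall>(X :: 'a set) d (Y :: 'b topology) e (Z :: 'c topology) k.
      Metric_space X d \<and>
      Hewitt_realcompactification (Metric_space.mtopology X d) Y e \<and>
      Samuel_realcompactification X (metric_uniformity X d) Z k \<and>
      equivalent_realcompactifications (Metric_space.mtopology X d) Y e Z k
      \<longrightarrow> Bourbaki_complete X d)"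
proof (intro conjI allI impI; elim conjE)
  fix X :: "'a set" and \<mu> and Y :: "'b topology" and e and Z :: "'c topology" and k
  assume "covering_uniformity X \<mu>" "Hewitt_realcompactification (uniform_topology X \<mu>) Y e"
    "Samuel_realcompactification X \<mu> Z k"
    "equivalent_realcompactifications (uniform_topology X \<mu>) Y e Z k"
  then show "C_fun (uniform_topology X \<mu>) = CC_fun X (weak_uniformity X \<mu>)"
    by (rule C_fun_eq_CC_fun)
next
  fix X :: "'a set" and d and Y :: "'b topology" and e and Z :: "'c topology" and k
  assume d: "Metric_space X d" and Y: "Hewitt_realcompactification (Metric_space.mtopology X d) Y e"
    and Z: "Samuel_realcompactification X (metric_uniformity X d) Z k"
    and eq: "equivalent_realcompactifications (Metric_space.mtopology X d) Y e Z k"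
  have "C_fun (Metric_space.mtopology X d) = CC_fun X (weak_uniformity X (metric_uniformity X d))"
    by (rule C_fun_eq_CC_fun[OF Metric_space.covering_uniformity_metric[OF d] _ Z,
        unfolded Metric_space.uniform_topology_metric[OF d], OF Y eq])
  then show "Bourbaki_complete X d"
    by (intro Metric_space.Bourbaki_complete_if_C_fun_subset_CC_fun[OF d]) simp
qed

end
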